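(* Let $\alpha\ge 1$ be an integer, let $N>2\alpha$, and let $B_1$ be the open unit ball of $\mathbb{R}^N$. Let $p,q\ge 1$, not both equal to $1$, be such that $(p,q)$ lies below the critical hyperbola, i.e. \[ \frac{1}{p+1}+\frac{1}{q+1}>\frac{N-2\alpha}{N}. \] Then there exists a classical nontrivial solution $(u,v)$ of \[ \begin{cases} (-\Delta)^{\alpha} u=|v|^q & \text{in } B_1,\\ (-\Delta)^{\alpha} v=|u|^p & \text{in } B_1,\\ \frac{\partial^{r} u}{\partial \nu^{r}}=\frac{\partial^{r} v}{\partial \nu^{r}}=0,\quad r=0,\dots,\alpha-1, & \text{on } \partial B_1. \end{cases} \]
   Context: $(-\Delta)^{\alpha}=-\Delta\big((-\Delta)^{\alpha-1}\big)$ is the polyharmonic operator, and $\nu$ is the outward pointing normal on $\partial B_1$. A classical solution is a pair $(u,v)\in C^{2\alpha}(\bar B_1)\times C^{2\alpha}(\bar B_1)$ satisfying the equations and boundary conditions pointwise; nontrivial means $(u,v)\neq(0,0)$. *)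

theory Defs
  imports "HOL-Analysis.Analysis"
begin

(* C^k of the closure of an open set S, in the usual PDE sense: all partial derivatives
   of order at most k exist in S and extend continuously to the closure of S.
   The function g below is the continuous extension of the b-th partial derivative;
   values outside the closure are irrelevant. *)
primrec C_closure :: "nat \<Rightarrow> 'a::euclidean_space set \<Rightarrow> ('a \<Rightarrow> real) set" where
  "C_closure 0 S = {f. continuous_on (closure S) f}"
| "C_closure (Suc k) S =
     {f. continuous_on (closure S) f \<and>
         (\<forall>b\<in>Basis. \<exists>g\<in>C_closure k S.
            \<forall>x\<in>S. ((\<lambda>t. f (x + t *\<^sub>R b)) has_real_derivative g x) (at 0))}"

definition partial_deriv :: "'a::euclidean_space \<Rightarrow> ('a \<Rightarrow> real) \<Rightarrow> 'a \<Rightarrow> real" where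
  "partial_deriv b f x = deriv (\<lambda>t. f (x + t *\<^sub>R b)) 0"

definition laplacian :: "('a::euclidean_space \<Rightarrow> real) \<Rightarrow> 'a \<Rightarrow> real" where
  "laplacian f x = (\<Sum>b\<in>Basis. partial_deriv b (partial_deriv b f) x)"

primrec polyharmonic :: "nat \<Rightarrow> ('a::euclidean_space \<Rightarrow> real) \<Rightarrow> 'a \<Rightarrow> real" where
  "polyharmonic 0 f = f"
| "polyharmonic (Suc m) f = (\<lambda>x. - laplacian (polyharmonic m f) x)"

primrec deriv_within :: "nat \<Rightarrow> real set \<Rightarrow> (real \<Rightarrow> real) \<Rightarrow> real \<Rightarrow> real" where
  "deriv_within 0 T \<phi> = \<phi>"
| "deriv_within (Suc r) T \<phi> = (\<lambda>t. vector_derivative (deriv_within r T \<phi>) (at t within T))"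

(* The r-th derivative at t = 0 of t \<mapsto> f (x + t \<nu>), taken within the closure of S.
   At a boundary point x with outward normal \<nu> it is one-sided, as f is only
   meaningful on the closure. *)
definition normal_deriv ::
    "'a::euclidean_space set \<Rightarrow> 'a \<Rightarrow> nat \<Rightarrow> ('a \<Rightarrow> real) \<Rightarrow> 'a \<Rightarrow> real" where
  "normal_deriv S \<nu> r f x =
     deriv_within r {t. x + t *\<^sub>R \<nu> \<in> closure S} (\<lambda>t. f (x + t *\<^sub>R \<nu>)) 0"

(* The outward unit normal of the unit ball at a boundary point x is x itself. *)
definition dirichlet_unit_ball :: "nat \<Rightarrow> ('a::euclidean_space \<Rightarrow> real) \<Rightarrow> bool" where
  "dirichlet_unit_ball \<alpha> f \<longleftrightarrow>
     (\<forall>x\<in>sphere 0 1. \<forall>r<\<alpha>. normal_deriv (ball 0 1) x r f x = 0)"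

definition classical_solution ::
    "nat \<Rightarrow> real \<Rightarrow> real \<Rightarrow> ('a::euclidean_space \<Rightarrow> real) \<Rightarrow> ('a \<Rightarrow> real) \<Rightarrow> bool" where
  "classical_solution \<alpha> p q u v \<longleftrightarrow>
     u \<in> C_closure (2 * \<alpha>) (ball 0 1) \<and> v \<in> C_closure (2 * \<alpha>) (ball 0 1) \<and>
     (\<forall>x\<in>ball 0 1. polyharmonic \<alpha> u x = \<bar>v x\<bar> powr q) \<and>
     (\<forall>x\<in>ball 0 1. polyharmonic \<alpha> v x = \<bar>u x\<bar> powr p) \<and>
     dirichlet_unit_ball \<alpha> u \<and> dirichlet_unit_ball \<alpha> v"

end

theory Submission
  imports Defs "HOL-Complex_Analysis.Great_Picard"
begin

text \<open>We look for radial solutions. In the variable \<open>t = |x|^2\<close>, with \<open>c = N / 2\<close>, the operator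
  \<open>(- \<Delta>)^m\<close> equals
  \<open>4^m (\<theta> + c) (\<theta> + c + 1) \<dots> (\<theta> + c + m - 1) (- d/dt)^m\<close>,
  where \<open>\<theta> = t d/dt\<close>, so the Dirichlet problem for radial data is solved by an explicit operator: \<open>m\<close>
  inverse Euler operators followed by \<open>m\<close> integrations from the boundary. This Green operator is
  visibly positive, and it is symmetric for the weight \<open>t powr (c - 1)\<close>. Alternating it with the
  powers \<open>p\<close> and \<open>q\<close> and normalising gives an iteration along which a level increases, with equality
  only at fixed points. Radially decreasing normalised profiles are bounded by a power of \<open>t\<close>; below
  the critical hyperbola each step improves this power by a fixed amount, so the iterates become
  bounded and equi-Lipschitz, and a limit point solves the system up to factors, which are scaled
  away because \<open>p * q \<noteq> 1\<close>.\<close>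

section \<open>Inverse Euler operators and tail integrals\<close>

text \<open>The delicate point is regularity at \<open>t = 1\<close>. Both profiles vanish there, so
  their real powers need not have \<open>\<alpha>\<close> derivatives at that end, while
  \<open>2 * \<alpha>\<close> derivatives up to the boundary are required. The two ends of the
  interval are therefore treated differently. Away from \<open>t = 0\<close> an inverse Euler
  operator gains a derivative, since \<open>t * u' + c * u = f\<close> can be solved for
  \<open>u'\<close>. Near \<open>t = 0\<close> this fails, but there the profiles are positive and
  their powers are as smooth as they are. Glued together, this gives \<open>\<alpha>\<close>
  derivatives before the \<open>\<alpha>\<close> integrations. Where the critical hyperbola enters:
  with \<open>a = c / (p + 1)\<close>, \<open>b = c / (q + 1)\<close> and \<open>m\<close> for
  \<open>\<alpha>\<close>, a normalised decreasing profile is at most a constant times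
  \<open>t powr (- a)\<close>. Its \<open>p\<close>-th power has exponent
  \<open>p * a = c - a\<close>, and the Green operator lowers an exponent by any amount below
  \<open>m\<close>. The new exponent can beat \<open>b\<close> because \<open>c - a - m < b\<close>,
  which is the subcritical condition multiplied by \<open>c\<close>. The variable
  \<open>t = |x|^2\<close> also removes the origin as a special point: a \<open>k\<close> times
  continuously differentiable function of \<open>t\<close> on \<open>{0..1}\<close> gives one of
  \<open>x\<close> on the closed ball.\<close>

text \<open>The solution of \<open>t * u' + c * u = f\<close> that stays regular at
  \<open>t = 0\<close>. Written as a weighted average of dilations over a fixed interval, without
  the factor \<open>t powr (- c)\<close>, it treats \<open>t = 0\<close> as an ordinary point and
  lets derivatives in \<open>t\<close> pass under the integral.\<close>

definition euler_inv :: "real \<Rightarrow> (real \<Rightarrow> real) \<Rightarrow> real \<Rightarrow> real" where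
  "euler_inv c f t = integral {0..1} (\<lambda>s. s powr (c - 1) * f (t * s))"

definition tail_int :: "(real \<Rightarrow> real) \<Rightarrow> real \<Rightarrow> real" where
  "tail_int f t = integral {t..1} f"

primrec euler_stack :: "nat \<Rightarrow> real \<Rightarrow> (real \<Rightarrow> real) \<Rightarrow> real \<Rightarrow> real" where
  "euler_stack 0 c f = f"
| "euler_stack (Suc k) c f = euler_inv (c + real k) (euler_stack k c f)"

text \<open>The tail integrals come last: \<open>m\<close> integrations from \<open>t = 1\<close>
  produce a zero of order \<open>m\<close> there, which is the Dirichlet condition.\<close>

definition green :: "nat \<Rightarrow> real \<Rightarrow> (real \<Rightarrow> real) \<Rightarrow> real \<Rightarrow> real" where
  "green m c f t = (tail_int ^^ m) (euler_stack m c f) t / 4 ^ m"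

text \<open>For \<open>c = N / 2\<close> the hypothesis says \<open>N > 2\<close>; it keeps the
  weight continuous at 0, so that weighted integrals of continuous functions have continuous
  integrands.\<close>

lemma continuous_on_powr_unit: "c > 1 \<Longrightarrow> continuous_on {0..1::real} (\<lambda>s. s powr (c - 1))"
  by (intro continuous_on_powr') (auto intro: continuous_intros)

lemma euler_inv_integrand_continuous:
  fixes f :: "real \<Rightarrow> real"
  assumes "continuous_on S f" "\<And>s. s \<in> {0..1} \<Longrightarrow> t * s \<in> S" "c > 1"
  shows "continuous_on {0..1} (\<lambda>s. s powr (c - 1) * f (t * s))"
  by (intro continuous_on_mult continuous_on_powr_unit continuous_on_compose2[OF assms(1)] continuous_intros)
     (use assms in auto)

lemma mult_unit_interval: "t \<in> {0..1} \<Longrightarrow> s \<in> {0..1} \<Longrightarrow> t * s \<in> {0..1::real}"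
  by (auto intro: mult_le_one)

lemma euler_inv_integrand_continuous':
  fixes f :: "real \<Rightarrow> real"
  assumes "continuous_on {0..1} f" "t \<in> {0..1}" "c > 1"
  shows "continuous_on {0..1} (\<lambda>s. s powr (c - 1) * f (t * s))"
  by (rule euler_inv_integrand_continuous[OF assms(1) mult_unit_interval[OF assms(2)] assms(3)])

lemma euler_inv_continuous:
  assumes "continuous_on S f" "\<And>t s. t \<in> S \<Longrightarrow> s \<in> {0..1} \<Longrightarrow> t * s \<in> S" "c > 1"
  shows "continuous_on S (euler_inv c f)"
proof -
  have "continuous_on (S \<times> {0..1}) (\<lambda>x. snd x powr (c - 1) * f (fst x * snd x))"
    by (intro continuous_intros continuous_on_compose2[OF assms(1)] continuous_on_powr')
       (use assms in auto)
  then show ?thesis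
    using integral_continuous_on_param[of S 0 1 "\<lambda>t s. s powr (c - 1) * f (t * s)"]
    by (simp add: euler_inv_def[abs_def] case_prod_unfold)
qed

lemma euler_inv_has_derivative:
  assumes f: "\<And>t. t \<in> S \<Longrightarrow> (f has_real_derivative g t) (at t within S)"
    and g: "continuous_on S g" and "convex S"
    and S: "\<And>t s. t \<in> S \<Longrightarrow> s \<in> {0..1} \<Longrightarrow> t * s \<in> S" and c: "c > 1" and t: "t \<in> S"
  shows "(euler_inv c f has_real_derivative euler_inv (c + 1) g t) (at t within S)"
proof -
  have contf: "continuous_on S f"
    using f DERIV_continuous by (fastforce simp: continuous_on_eq_continuous_within)
  have "((\<lambda>x. integral (cbox 0 1) (\<lambda>s. s powr (c - 1) * f (x * s))) has_field_derivative
         integral (cbox 0 1) (\<lambda>s. s powr c * g (t * s))) (at t within S)"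
  proof (rule leibniz_rule_field_derivative[OF _ _ _ t \<open>convex S\<close>])
    fix x s :: real assume x: "x \<in> S" and s: "s \<in> cbox 0 1"
    have "(f has_real_derivative g (x * s)) (at (x * s) within ((\<lambda>x. x * s) ` S))"
      by (rule has_field_derivative_subset[OF f]) (use x s S in auto)
    then have "(f \<circ> (\<lambda>x. x * s) has_real_derivative g (x * s) * s) (at x within S)"
      by (rule DERIV_image_chain) (auto intro!: derivative_eq_intros)
    then have "((\<lambda>x. s powr (c - 1) * f (x * s)) has_real_derivative s powr (c - 1) * (g (x * s) * s))
        (at x within S)"
      by (intro DERIV_cmult) (simp add: o_def)
    moreover have "s powr (c - 1) * (g (x * s) * s) = s powr c * g (x * s)"
      using s powr_mult_base[of s "c - 1"] by (simp add: mult_ac)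
    ultimately show "((\<lambda>x. s powr (c - 1) * f (x * s)) has_real_derivative s powr c * g (x * s))
        (at x within S)" by simp
  next
    fix x assume "x \<in> S"
    then show "(\<lambda>s. s powr (c - 1) * f (x * s)) integrable_on cbox 0 1"
      using euler_inv_integrand_continuous[OF contf S[of x] c]
      by (auto intro: integrable_continuous_interval)
  next
    have "continuous_on (S \<times> {0..1}) (\<lambda>x. snd x powr c * g (fst x * snd x))"
      by (intro continuous_intros continuous_on_compose2[OF g] continuous_on_powr')
         (use S c in auto)
    then show "continuous_on (S \<times> cbox 0 1) (\<lambda>(x, s). s powr c * g (x * s))"
      by (simp add: case_prod_unfold)
  qed
  then show ?thesis by (simp add: euler_inv_def[abs_def])
qed

text \<open>Integrate the derivative of \<open>s \<mapsto> s powr c * f (t * s)\<close> over the unit interval.\<close>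

lemma euler_inv_euler_operator:
  assumes f: "\<And>t. t \<in> S \<Longrightarrow> (f has_real_derivative g t) (at t within S)"
    and g: "continuous_on S g"
    and S: "\<And>t s. t \<in> S \<Longrightarrow> s \<in> {0..1} \<Longrightarrow> t * s \<in> S" and c: "c > 1" and t: "t \<in> S"
  shows "t * euler_inv (c + 1) g t + c * euler_inv c f t = f t"
proof -
  have contf: "continuous_on S f"
    using f DERIV_continuous by (fastforce simp: continuous_on_eq_continuous_within)
  have cont: "continuous_on {0..1} (\<lambda>s. s powr c * f (t * s))"
    using euler_inv_integrand_continuous[OF contf S[OF t], of "c + 1"] c by simp
  have c1: "continuous_on {0..1} (\<lambda>s. s powr c * g (t * s))"
    using euler_inv_integrand_continuous[OF g S[OF t], of "c + 1"] c by simp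
  have c2: "continuous_on {0..1} (\<lambda>s. s powr (c - 1) * f (t * s))"
    using euler_inv_integrand_continuous[OF contf S[OF t]] c by simp
  have "((\<lambda>s. t * (s powr c * g (t * s)) + c * (s powr (c - 1) * f (t * s)))
          has_integral (1 powr c * f (t * 1) - 0 powr c * f (t * 0))) {0..1}"
  proof (rule fundamental_theorem_of_calculus_interior[OF _ cont])
    fix s :: real assume s: "s \<in> {0<..<1}"
    have "(f has_real_derivative g (t * s)) (at (t * s) within ((\<lambda>x. t * x) ` {0..1}))"
      by (rule has_field_derivative_subset[OF f]) (use t s S in auto)
    then have "(f \<circ> (\<lambda>x. t * x) has_real_derivative g (t * s) * t) (at s within {0..1})"
      by (rule DERIV_image_chain) (auto intro!: derivative_eq_intros)
    then have "((\<lambda>s. f (t * s)) has_real_derivative g (t * s) * t) (at s)"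
      using s at_within_interior[of s "{0..1}"] by (simp add: o_def)
    then have "((\<lambda>s. s powr c * f (t * s)) has_real_derivative
        c * s powr (c - 1) * f (t * s) + g (t * s) * t * s powr c) (at s)"
      using s by (auto intro!: derivative_eq_intros simp: has_real_derivative_powr)
    then show "((\<lambda>s. s powr c * f (t * s)) has_vector_derivative
        t * (s powr c * g (t * s)) + c * (s powr (c - 1) * f (t * s))) (at s)"
      by (simp add: has_real_derivative_iff_has_vector_derivative algebra_simps)
  qed simp
  moreover have "((\<lambda>s. t * (s powr c * g (t * s)) + c * (s powr (c - 1) * f (t * s)))
          has_integral (t * euler_inv (c + 1) g t + c * euler_inv c f t)) {0..1}"
    unfolding euler_inv_def
    by (intro has_integral_add has_integral_mult_right)
       (use c1 c2 integrable_integral[OF integrable_continuous_interval] in simp_all)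
  ultimately have "1 powr c * f (t * 1) - 0 powr c * f (t * 0) = t * euler_inv (c + 1) g t + c * euler_inv c f t"
    by (rule has_integral_unique)
  then show ?thesis by simp
qed

text \<open>Substitution in the integral. This Volterra form serves two purposes: it shows the gain
  of a derivative for \<open>t > 0\<close>, and it identifies weighted head integrals with inverse
  Euler operators.\<close>

lemma euler_inv_eq_integral:
  assumes f: "continuous_on {0..1} f" and c: "c > 1" and t: "t \<in> {0..1}"
  shows "t powr c * euler_inv c f t = integral {0..t} (\<lambda>s. s powr (c - 1) * f s)"
proof (cases "t = 0")
  case False
  then have t0: "t > 0" using t by auto
  have "continuous_on {0..t} (\<lambda>s. s powr (c - 1) * f s)"
    by (intro continuous_intros continuous_on_subset[OF continuous_on_powr_unit[OF c]]
        continuous_on_subset[OF f]) (use t in auto)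
  then have "((\<lambda>s. s powr (c - 1) * f s) has_integral integral {0..t} (\<lambda>s. s powr (c - 1) * f s)) {0..t}"
    using integrable_continuous_interval integrable_integral by blast
  from has_integral_stretch_real[OF this, of t] False
  have "((\<lambda>s. (t * s) powr (c - 1) * f (t * s)) has_integral
     integral {0..t} (\<lambda>s. s powr (c - 1) * f s) / t) ((\<lambda>x. x / t) ` {0..t})"
    using t0 by simp
  moreover have "(\<lambda>x. x / t) ` {0..t} = {0..1}"
    using t0 by (auto simp: image_iff intro!: bexI[of _ "_ * t"] mult_left_le_one_le)
  ultimately have 1: "integral {0..1} (\<lambda>s. (t * s) powr (c - 1) * f (t * s)) =
     integral {0..t} (\<lambda>s. s powr (c - 1) * f s) / t"
    by (simp add: integral_unique)
  have "integral {0..1} (\<lambda>s. (t * s) powr (c - 1) * f (t * s)) =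
        integral {0..1} (\<lambda>s. t powr (c - 1) * (s powr (c - 1) * f (t * s)))"
    by (rule integral_cong) (use t0 in \<open>auto simp: powr_mult\<close>)
  also have "\<dots> = t powr (c - 1) * euler_inv c f t"
    by (simp add: euler_inv_def)
  finally have "t * (t powr (c - 1) * euler_inv c f t) = integral {0..t} (\<lambda>s. s powr (c - 1) * f s)"
    using 1 t0 by (simp add: field_simps)
  then show ?thesis
    using t0 powr_mult_base[of t "c - 1"] by (simp flip: mult.assoc)
qed simp

text \<open>Here \<open>f\<close> is merely continuous and the result is still differentiable: the
  Euler equation solved for the derivative. The price is the division by \<open>t\<close>.\<close>

lemma euler_inv_has_derivative_pos:
  assumes f: "continuous_on {0..1} f" and c: "c > 1" and t: "t \<in> {0<..1}"
  shows "(euler_inv c f has_real_derivative (f t - c * euler_inv c f t) / t) (at t within {0<..1})"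
proof -
  define V where "V = (\<lambda>t. integral {0..t} (\<lambda>s. s powr (c - 1) * f s))"
  have "(V has_real_derivative t powr (c - 1) * f t) (at t within {0..1})"
    unfolding V_def
    by (rule integral_has_real_derivative)
       (use t in \<open>auto intro!: continuous_intros continuous_on_powr_unit f c\<close>)
  then have V: "(V has_real_derivative t powr (c - 1) * f t) (at t within {0<..1})"
    by (rule has_field_derivative_subset) auto
  have E: "euler_inv c f s = s powr (- c) * V s" if "s \<in> {0<..1}" for s
    using euler_inv_eq_integral[OF f c, of s] that
    by (simp add: V_def powr_minus field_simps)
  have "((\<lambda>s. s powr (- c) * V s) has_real_derivative
      (- c) * t powr (- c - 1) * V t + t powr (c - 1) * f t * t powr (- c)) (at t within {0<..1})"
    by (intro DERIV_mult V has_field_derivative_at_within[OF has_real_derivative_powr]) (use t in auto)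
  moreover have "(- c) * t powr (- c - 1) * V t + t powr (c - 1) * f t * t powr (- c) =
      (f t - c * euler_inv c f t) / t"
  proof -
    have "t powr (- c - 1) = t powr (- c) / t" "t powr (c - 1) * t powr (- c) = 1 / t"
      using t by (auto simp: powr_diff powr_minus field_simps)
    then show ?thesis using E[OF t] by (simp add: diff_divide_distrib) (simp add: algebra_simps)
  qed
  ultimately have "((\<lambda>s. s powr (- c) * V s) has_real_derivative (f t - c * euler_inv c f t) / t)
     (at t within {0<..1})" by simp
  then show ?thesis
    by (rule has_field_derivative_transform_within[of _ _ _ _ 1]) (use t E in auto)
qed

lemma integral_nonneg_real:
  fixes f :: "real \<Rightarrow> real"
  assumes "\<And>x. x \<in> S \<Longrightarrow> 0 \<le> f x"
  shows "0 \<le> integral S f"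
  using assms by (cases "f integrable_on S") (auto simp: integral_nonneg not_integrable_integral)

lemma euler_inv_nonneg:
  assumes "\<And>t. t \<in> {0..1} \<Longrightarrow> f t \<ge> 0" "t \<in> {0..1}"
  shows "euler_inv c f t \<ge> 0"
  unfolding euler_inv_def
  by (intro integral_nonneg_real) (use assms mult_unit_interval in \<open>auto\<close>)

lemma euler_inv_diff:
  assumes "continuous_on {0..1} f" "continuous_on {0..1} g" "c > 1" "t \<in> {0..1}"
  shows "euler_inv c (\<lambda>s. f s - g s) t = euler_inv c f t - euler_inv c g t"
  unfolding euler_inv_def right_diff_distrib
  by (intro integral_diff integrable_continuous_interval euler_inv_integrand_continuous') (use assms in auto)

lemma euler_inv_cmult: "euler_inv c (\<lambda>s. k * f s) t = k * euler_inv c f t"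
  unfolding euler_inv_def by (simp add: mult.left_commute)

lemma integral_powr_unit: "c > 0 \<Longrightarrow> integral {0..1} (\<lambda>s::real. s powr (c - 1)) = 1 / c"
  using has_integral_powr_from_0[of "c - 1" 1] by (simp add: integral_unique)

lemma euler_inv_abs_le:
  assumes f: "continuous_on {0..1} f" and c: "c > 1" and t: "t \<in> {0..1}"
    and M: "\<And>t. t \<in> {0..1} \<Longrightarrow> \<bar>f t\<bar> \<le> M"
  shows "\<bar>euler_inv c f t\<bar> \<le> M"
proof -
  have "norm (euler_inv c f t) \<le> integral {0..1} (\<lambda>s. s powr (c - 1) * M)"
    unfolding euler_inv_def
  proof (rule integral_norm_bound_integral)
    show "(\<lambda>s. s powr (c - 1) * f (t * s)) integrable_on {0..1}"
      by (intro integrable_continuous_interval euler_inv_integrand_continuous' f c t)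
    show "(\<lambda>s. s powr (c - 1) * M) integrable_on {0..1}"
      by (intro integrable_continuous_interval continuous_intros continuous_on_powr_unit c)
    show "norm (s powr (c - 1) * f (t * s)) \<le> s powr (c - 1) * M" if "s \<in> {0..1}" for s
      using M[OF mult_unit_interval[OF t that]] by (simp add: abs_mult mult_left_mono)
  qed
  also have "\<dots> = M / c" using c by (simp add: integral_powr_unit)
  also have "\<dots> \<le> M"
  proof -
    have "M \<ge> 0" using M[of 0] by simp
    then have "M * 1 \<le> M * c" using c by (intro mult_left_mono) auto
    then show ?thesis using c by (simp add: divide_le_eq)
  qed
  finally show ?thesis by simp
qed

text \<open>A power \<open>t powr (- d)\<close> is an eigenfunction with eigenvalue
  \<open>1 / (c - d)\<close>, and \<open>d < c\<close> is exactly integrability at 0. The exponent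
  is preserved; only \<open>tail_int\<close> improves it.\<close>

lemma euler_inv_weighted_bound:
  assumes f: "continuous_on {0..1} f" and c: "c > 1" and t: "t \<in> {0<..1}" and "d < c"
    and C: "\<And>t. t \<in> {0<..1} \<Longrightarrow> \<bar>f t\<bar> \<le> C * t powr (- d)"
  shows "\<bar>euler_inv c f t\<bar> \<le> C / (c - d) * t powr (- d)"
proof -
  have "norm (euler_inv c f t) \<le> integral {0..1} (\<lambda>s. C * t powr (- d) * s powr (c - d - 1))"
    unfolding euler_inv_def
  proof (rule integral_norm_bound_integral)
    show "(\<lambda>s. s powr (c - 1) * f (t * s)) integrable_on {0..1}"
      by (intro integrable_continuous_interval euler_inv_integrand_continuous' f c) (use t in auto)
    have "(\<lambda>s::real. s powr (c - d - 1)) integrable_on {0..1}"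
      using has_integral_powr_from_0[of "c - d - 1" 1] \<open>d < c\<close> by (auto simp: integrable_on_def)
    then show "(\<lambda>s. C * t powr (- d) * s powr (c - d - 1)) integrable_on {0..1}"
      by (intro integrable_on_mult_right)
    show "norm (s powr (c - 1) * f (t * s)) \<le> C * t powr (- d) * s powr (c - d - 1)" if "s \<in> {0..1}" for s
    proof (cases "s = 0")
      case False
      then have s: "s > 0" using that by auto
      have "\<bar>f (t * s)\<bar> \<le> C * (t * s) powr (- d)"
        by (rule C) (use t s that in \<open>auto intro: mult_le_one\<close>)
      then have "s powr (c - 1) * \<bar>f (t * s)\<bar> \<le> s powr (c - 1) * (C * (t * s) powr (- d))"
        by (intro mult_left_mono) auto
      also have "\<dots> = C * t powr (- d) * (s powr (c - 1) * s powr (- d))"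
        using s t by (simp add: powr_mult)
      also have "s powr (c - 1) * s powr (- d) = s powr (c - d - 1)"
        by (simp flip: powr_add add: algebra_simps)
      finally show ?thesis by (simp add: abs_mult)
    qed simp
  qed
  also have "\<dots> = C / (c - d) * t powr (- d)"
    using integral_powr_unit[of "c - d"] \<open>d < c\<close> by simp
  finally show ?thesis by simp
qed

text \<open>If the integral vanished, so would \<open>f (t * s)\<close> for all \<open>s\<close> in
  \<open>{0<..1}\<close>, and letting \<open>s\<close> tend to 0 would give \<open>f 0 = 0\<close>.
  Positivity is asked only at 0 because the data have zeros at \<open>t = 1\<close>.\<close>

lemma euler_inv_pos:
  assumes f: "continuous_on {0..1} f" and c: "c > 1" and t: "t \<in> {0..1}"
    and nn: "\<And>t. t \<in> {0..1} \<Longrightarrow> f t \<ge> 0" and f0: "f 0 > 0"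
  shows "euler_inv c f t > 0"
proof (rule ccontr)
  assume "\<not> ?thesis"
  then have "integral {0..1} (\<lambda>s. s powr (c - 1) * f (t * s)) = 0"
    using euler_inv_nonneg[of f t c, OF nn t] unfolding euler_inv_def by simp
  moreover have "0 \<le> s powr (c - 1) * f (t * s)" if "s \<in> {0..1}" for s
    using nn[OF mult_unit_interval[OF t that]] by simp
  ultimately have z: "s powr (c - 1) * f (t * s) = 0" if "s \<in> {0..1}" for s
    using integral_eq_0_iff[OF euler_inv_integrand_continuous'[OF f t c]] that by auto
  have z': "f (t * s) = 0" if "s \<in> {0<..1}" for s
    using z[of s] that by auto
  have "((\<lambda>s. f (t * s)) \<longlongrightarrow> f (t * 0)) (at 0 within {0..1})"
    by (rule continuous_on_tendsto_compose[OF f]) 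
       (use mult_unit_interval[OF t] in \<open>auto intro!: tendsto_mult_right_zero simp: eventually_at_filter\<close>)
  moreover have "((\<lambda>s. f (t * s)) \<longlongrightarrow> 0) (at 0 within {0..1})"
    by (rule Lim_transform_within[OF tendsto_const, of 1]) (use z' in \<open>auto simp: dist_real_def\<close>)
  moreover have "at (0::real) within {0..1} \<noteq> bot"
    using connected_imp_perfect[of "{0..1::real}" 0] by (force simp: trivial_limit_within)
  ultimately have "f 0 = 0" using tendsto_unique by fastforce
  with f0 show False by simp
qed

lemma tail_int_has_derivative:
  assumes "continuous_on {0..1} f" "t \<in> {0..1}"
  shows "(tail_int f has_real_derivative - f t) (at t within {0..1})"
  using integral_has_real_derivative'[OF assms] by (simp add: tail_int_def[abs_def])

lemma tail_int_continuous:
  "continuous_on {0..1} f \<Longrightarrow> continuous_on {0..1} (tail_int f)"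
  using tail_int_has_derivative DERIV_continuous
  by (fastforce simp: continuous_on_eq_continuous_within)

lemma tail_int_at_1 [simp]: "tail_int f 1 = 0"
  by (simp add: tail_int_def)

lemma tail_int_integrable:
  "continuous_on {0..1} f \<Longrightarrow> t \<in> {0..1} \<Longrightarrow> f integrable_on {t..1::real}"
  for f :: "real \<Rightarrow> real"
  by (rule integrable_continuous_interval, rule continuous_on_subset) auto

lemma tail_int_diff:
  "continuous_on {0..1} f \<Longrightarrow> continuous_on {0..1} g \<Longrightarrow> t \<in> {0..1} \<Longrightarrow>
   tail_int (\<lambda>s. f s - g s) t = tail_int f t - tail_int g t"
  unfolding tail_int_def by (intro integral_diff tail_int_integrable)

lemma tail_int_cmult: "tail_int (\<lambda>s. k * f s) t = k * tail_int f t"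
  unfolding tail_int_def by simp

lemma tail_int_nonneg:
  "(\<And>t. t \<in> {0..1} \<Longrightarrow> f t \<ge> 0) \<Longrightarrow> t \<in> {0..1} \<Longrightarrow> tail_int f t \<ge> 0"
  unfolding tail_int_def by (intro integral_nonneg_real) auto

lemma tail_int_split:
  assumes "continuous_on {0..1} f" "0 \<le> s" "s \<le> t" "t \<le> 1"
  shows "tail_int f s = integral {s..t} f + tail_int f t"
  unfolding tail_int_def
  by (rule Henstock_Kurzweil_Integration.integral_combine[symmetric]) (use assms tail_int_integrable in auto)

lemma tail_int_antimono:
  assumes "continuous_on {0..1} f" "\<And>t. t \<in> {0..1} \<Longrightarrow> f t \<ge> 0" "0 \<le> s" "s \<le> t" "t \<le> 1"
  shows "tail_int f t \<le> tail_int f s"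
  unfolding tail_int_split[OF assms(1,3,4,5)]
  using integral_nonneg_real[of "{s..t}" f] assms by auto

lemma tail_int_lipschitz:
  assumes f: "continuous_on {0..1} f" and M: "\<And>t. t \<in> {0..1} \<Longrightarrow> \<bar>f t\<bar> \<le> M"
    and "s \<in> {0..1}" "t \<in> {0..1}"
  shows "\<bar>tail_int f s - tail_int f t\<bar> \<le> M * \<bar>s - t\<bar>"
  using assms(3,4)
proof (induction s t rule: linorder_wlog)
  case (le s t)
  have "norm (integral {s..t} f) \<le> M * (t - s)"
    by (rule integral_bound) (use le M in \<open>auto intro: continuous_on_subset[OF f]\<close>)
  then show ?case using tail_int_split[OF f, of s t] le by simp
next
  case (sym s t) then show ?case by (simp add: abs_minus_commute)
qed

lemma tail_int_abs_le:
  assumes f: "continuous_on {0..1} f" and M: "\<And>t. t \<in> {0..1} \<Longrightarrow> \<bar>f t\<bar> \<le> M" and "t \<in> {0..1}"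
  shows "\<bar>tail_int f t\<bar> \<le> M"
proof -
  have "\<bar>tail_int f t\<bar> \<le> M * \<bar>t - 1\<bar>"
    using tail_int_lipschitz[of f M t 1, OF f M] assms by simp
  also have "\<dots> \<le> M * 1" using M[of 0] assms(3) by (intro mult_left_mono) auto
  finally show ?thesis by simp
qed

lemma tail_int_pos:
  assumes f: "continuous_on {0..1} f" and pos: "\<And>t. t \<in> {0..<1} \<Longrightarrow> f t > 0"
    and nn: "\<And>t. t \<in> {0..1} \<Longrightarrow> f t \<ge> 0" and t: "t \<in> {0..<1}"
  shows "tail_int f t > 0"
proof (rule ccontr)
  assume "\<not> ?thesis"
  then have "integral {t..1} f = 0" using tail_int_nonneg[of f t, OF nn] t by (simp add: tail_int_def)
  moreover have "continuous_on {t..1} f" using t by (auto intro: continuous_on_subset[OF f])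
  ultimately have "\<forall>x\<in>{t..1}. f x = 0"
    by (subst (asm) integral_eq_0_iff) (use t nn in auto)
  then have "f t = 0" using t by simp
  with pos[OF t] show False by simp
qed

text \<open>On \<open>{t..1}\<close> the factor \<open>s powr (- e)\<close> is at most
  \<open>t powr (- e)\<close>, and the remaining power \<open>e - d > - 1\<close> is integrable.
  Excluding \<open>e = d - 1\<close> avoids the logarithm at \<open>d = 1\<close>, so one estimate
  covers all exponents.\<close>

lemma tail_int_weighted_bound:
  assumes f: "continuous_on {0..1} f" and t: "t \<in> {0<..1}" and e: "e \<ge> 0" "e > d - 1" 
    and C: "\<And>t. t \<in> {0<..1} \<Longrightarrow> \<bar>f t\<bar> \<le> C * t powr (- d)"
  shows "\<bar>tail_int f t\<bar> \<le> C / (e - d + 1) * t powr (- e)"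
proof -
  have C0: "C \<ge> 0" using C[of 1] by auto
  have int: "(\<lambda>s. C * t powr (- e) * s powr (e - d)) integrable_on {0..1}"
    using has_integral_powr_from_0[of "e - d" 1] e
    by (intro integrable_on_mult_right) (auto simp: integrable_on_def)
  have int': "(\<lambda>s. C * t powr (- e) * s powr (e - d)) integrable_on {t..1}"
    by (rule integrable_on_subinterval[OF int]) (use t in auto)
  have "norm (tail_int f t) \<le> integral {t..1} (\<lambda>s. C * t powr (- e) * s powr (e - d))"
    unfolding tail_int_def
  proof (rule integral_norm_bound_integral[OF tail_int_integrable[OF f] int'])
    fix s assume s: "s \<in> {t..1}"
    have "\<bar>f s\<bar> \<le> C * s powr (- d)" by (rule C) (use s t in auto)
    also have "s powr (- d) = s powr (- e) * s powr (e - d)" by (simp flip: powr_add)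
    also have "C * \<dots> \<le> C * (t powr (- e) * s powr (e - d))"
      by (intro mult_left_mono mult_right_mono powr_mono2' C0) (use s t e in auto)
    finally show "norm (f s) \<le> C * t powr (- e) * s powr (e - d)" by simp
  qed (use t in auto)
  also have "\<dots> \<le> integral {0..1} (\<lambda>s. C * t powr (- e) * s powr (e - d))"
    by (rule integral_subset_le[OF _ int' int]) (use t C0 in auto)
  also have "\<dots> = C / (e - d + 1) * t powr (- e)"
    using integral_powr_unit[of "e - d + 1"] e by simp
  finally show ?thesis by simp
qed

section \<open>The radial Green operator\<close>

lemma euler_inv_cong:
  assumes "\<And>t. t \<in> {0..1} \<Longrightarrow> f t = g t" "t \<in> {0..1}"
  shows "euler_inv c f t = euler_inv c g t"
  unfolding euler_inv_def by (rule integral_cong) (use assms mult_unit_interval in simp)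

lemma tail_int_cong:
  assumes "\<And>t. t \<in> {0..1} \<Longrightarrow> f t = g t" "t \<in> {0..1}"
  shows "tail_int f t = tail_int g t"
  unfolding tail_int_def by (rule integral_cong) (use assms in auto)

lemma euler_stack_continuous:
  assumes "continuous_on S f" "\<And>t s. t \<in> S \<Longrightarrow> s \<in> {0..1} \<Longrightarrow> t * s \<in> S" "c > 1"
  shows "continuous_on S (euler_stack k c f)"
  by (induction k) (use assms in \<open>auto intro!: euler_inv_continuous\<close>)

lemma euler_stack_continuous_unit:
  "continuous_on {0..1} f \<Longrightarrow> c > 1 \<Longrightarrow> continuous_on {0..1} (euler_stack k c f)"
  by (rule euler_stack_continuous) (use mult_unit_interval in blast)+

lemma tail_ints_continuous:
  "continuous_on {0..1} f \<Longrightarrow> continuous_on {0..1} ((tail_int ^^ k) f)"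
  by (induction k) (auto intro!: tail_int_continuous)

lemma green_continuous:
  "continuous_on {0..1} f \<Longrightarrow> c > 1 \<Longrightarrow> continuous_on {0..1} (green m c f)"
  unfolding green_def[abs_def]
  by (intro continuous_intros tail_ints_continuous euler_stack_continuous_unit) auto

lemma euler_stack_nonneg:
  assumes "\<And>t. t \<in> {0..1} \<Longrightarrow> f t \<ge> 0" "t \<in> {0..1}"
  shows "euler_stack k c f t \<ge> 0"
  using assms(2)
proof (induction k arbitrary: t)
  case (Suc k)
  show ?case unfolding euler_stack.simps by (rule euler_inv_nonneg) (use Suc in blast)+
qed (use assms in simp)

lemma tail_ints_nonneg:
  assumes "\<And>t. t \<in> {0..1} \<Longrightarrow> f t \<ge> 0" "t \<in> {0..1}"
  shows "(tail_int ^^ k) f t \<ge> 0"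
  using assms(2)
proof (induction k arbitrary: t)
  case (Suc k)
  show ?case unfolding funpow.simps o_apply by (rule tail_int_nonneg) (use Suc in blast)+
qed (use assms in simp)

lemma green_nonneg:
  "(\<And>t. t \<in> {0..1} \<Longrightarrow> f t \<ge> 0) \<Longrightarrow> t \<in> {0..1} \<Longrightarrow> green m c f t \<ge> 0"
  unfolding green_def by (intro divide_nonneg_nonneg tail_ints_nonneg euler_stack_nonneg) auto

lemma euler_stack_abs_le:
  assumes "continuous_on {0..1} f" "c > 1" "\<And>t. t \<in> {0..1} \<Longrightarrow> \<bar>f t\<bar> \<le> M" "t \<in> {0..1}"
  shows "\<bar>euler_stack k c f t\<bar> \<le> M"
  using assms(4)
proof (induction k arbitrary: t)
  case (Suc k)
  show ?case unfolding euler_stack.simps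
    by (rule euler_inv_abs_le[OF euler_stack_continuous_unit]) (use assms Suc in simp_all)
qed (use assms in simp)

lemma tail_ints_abs_le:
  assumes "continuous_on {0..1} f" "\<And>t. t \<in> {0..1} \<Longrightarrow> \<bar>f t\<bar> \<le> M" "t \<in> {0..1}"
  shows "\<bar>(tail_int ^^ k) f t\<bar> \<le> M"
  using assms(3)
proof (induction k arbitrary: t)
  case (Suc k)
  show ?case unfolding funpow.simps o_apply
    by (rule tail_int_abs_le[OF tail_ints_continuous]) (use assms Suc in simp_all)
qed (use assms in simp)

lemma green_abs_le:
  assumes "continuous_on {0..1} f" "c > 1" "\<And>t. t \<in> {0..1} \<Longrightarrow> \<bar>f t\<bar> \<le> M" "t \<in> {0..1}"
  shows "\<bar>green m c f t\<bar> \<le> M"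
proof -
  have "\<bar>(tail_int ^^ m) (euler_stack m c f) t\<bar> \<le> M"
    by (intro tail_ints_abs_le euler_stack_continuous_unit euler_stack_abs_le) (use assms in auto)
  moreover have "M \<ge> 0" using assms(3)[of 0] by simp
  then have "M * 1 \<le> M * 4 ^ m" by (intro mult_left_mono) auto
  ultimately show ?thesis by (simp add: green_def divide_le_eq)
qed

lemma euler_stack_diff:
  assumes "continuous_on {0..1} f" "continuous_on {0..1} g" "c > 1" "t \<in> {0..1}"
  shows "euler_stack k c (\<lambda>s. f s - g s) t = euler_stack k c f t - euler_stack k c g t"
  using assms(4)
proof (induction k arbitrary: t)
  case (Suc k)
  have "euler_stack (Suc k) c (\<lambda>s. f s - g s) t =
     euler_inv (c + real k) (\<lambda>s. euler_stack k c f s - euler_stack k c g s) t"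
    using Suc by (auto intro!: euler_inv_cong)
  also have "\<dots> = euler_stack (Suc k) c f t - euler_stack (Suc k) c g t"
    using assms Suc by (subst euler_inv_diff) (auto intro!: euler_stack_continuous_unit)
  finally show ?case .
qed simp

lemma tail_ints_diff:
  assumes "continuous_on {0..1} f" "continuous_on {0..1} g" "t \<in> {0..1}"
  shows "(tail_int ^^ k) (\<lambda>s. f s - g s) t = (tail_int ^^ k) f t - (tail_int ^^ k) g t"
  using assms(3)
proof (induction k arbitrary: t)
  case (Suc k)
  have "(tail_int ^^ Suc k) (\<lambda>s. f s - g s) t =
     tail_int (\<lambda>s. (tail_int ^^ k) f s - (tail_int ^^ k) g s) t"
    using Suc by (auto intro!: tail_int_cong)
  also have "\<dots> = (tail_int ^^ Suc k) f t - (tail_int ^^ Suc k) g t"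
    using assms Suc by (subst tail_int_diff) (auto intro!: tail_ints_continuous)
  finally show ?case .
qed simp

lemma tail_ints_cong:
  assumes "\<And>t. t \<in> {0..1} \<Longrightarrow> f t = g t" "t \<in> {0..1}"
  shows "(tail_int ^^ k) f t = (tail_int ^^ k) g t"
  using assms(2) by (induction k arbitrary: t) (auto intro!: tail_int_cong assms(1))

lemma euler_stack_cong:
  assumes "\<And>t. t \<in> {0..1} \<Longrightarrow> f t = g t" "t \<in> {0..1}"
  shows "euler_stack k c f t = euler_stack k c g t"
  using assms(2) by (induction k arbitrary: t) (auto intro!: euler_inv_cong assms(1))

lemma green_cong:
  assumes "\<And>t. t \<in> {0..1} \<Longrightarrow> f t = g t" "t \<in> {0..1}"
  shows "green m c f t = green m c g t"
  unfolding green_def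
  using tail_ints_cong[of "euler_stack m c f" "euler_stack m c g" t m] euler_stack_cong[of f g] assms
  by simp

lemma green_diff:
  assumes "continuous_on {0..1} f" "continuous_on {0..1} g" "c > 1" "t \<in> {0..1}"
  shows "green m c (\<lambda>s. f s - g s) t = green m c f t - green m c g t"
proof -
  have "(tail_int ^^ m) (euler_stack m c (\<lambda>s. f s - g s)) t =
        (tail_int ^^ m) (\<lambda>s. euler_stack m c f s - euler_stack m c g s) t"
    by (intro tail_ints_cong euler_stack_diff assms) auto
  also have "\<dots> = (tail_int ^^ m) (euler_stack m c f) t - (tail_int ^^ m) (euler_stack m c g) t"
    by (intro tail_ints_diff euler_stack_continuous_unit assms)
  finally show ?thesis by (simp add: green_def diff_divide_distrib)
qed

lemma green_dist_le:
  assumes "continuous_on {0..1} f" "continuous_on {0..1} g" "c > 1" "t \<in> {0..1}"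
    and "\<And>t. t \<in> {0..1} \<Longrightarrow> \<bar>f t - g t\<bar> \<le> M"
  shows "\<bar>green m c f t - green m c g t\<bar> \<le> M"
  using green_abs_le[of "\<lambda>s. f s - g s" c M t m] assms
  by (simp add: green_diff continuous_on_diff)

lemma euler_stack_cmult: "euler_stack n c (\<lambda>s. k * f s) = (\<lambda>t. k * euler_stack n c f t)"
  by (induction n) (auto simp: euler_inv_cmult)

lemma tail_ints_cmult: "(tail_int ^^ n) (\<lambda>s. k * f s) = (\<lambda>t. k * (tail_int ^^ n) f t)"
  by (induction n) (auto simp: tail_int_cmult)

lemma green_cmult: "green m c (\<lambda>s. k * f s) t = k * green m c f t"
  by (simp add: green_def euler_stack_cmult tail_ints_cmult)

lemma green_antimono:
  assumes "continuous_on {0..1} f" "c > 1" "\<And>t. t \<in> {0..1} \<Longrightarrow> f t \<ge> 0" "0 \<le> s" "s \<le> t" "t \<le> 1" "m \<ge> 1"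
  shows "green m c f t \<le> green m c f s"
proof -
  obtain k where m: "m = Suc k" using assms(7) by (cases m) auto
  have "tail_int ((tail_int ^^ k) (euler_stack m c f)) t \<le> tail_int ((tail_int ^^ k) (euler_stack m c f)) s"
    by (intro tail_int_antimono tail_ints_continuous tail_ints_nonneg euler_stack_continuous_unit
          euler_stack_nonneg) (use assms in auto)
  then show ?thesis by (simp add: green_def m divide_right_mono)
qed

text \<open>The outermost operation is an integration, so a sup bound one stage earlier is a
  Lipschitz bound. This supplies equicontinuity of the iterates.\<close>

lemma green_lipschitz:
  assumes "continuous_on {0..1} f" "c > 1" "\<And>t. t \<in> {0..1} \<Longrightarrow> \<bar>f t\<bar> \<le> M"
    "s \<in> {0..1}" "t \<in> {0..1}" "m \<ge> 1"
  shows "\<bar>green m c f s - green m c f t\<bar> \<le> M * \<bar>s - t\<bar>"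
proof -
  obtain k where m: "m = Suc k" using assms(6) by (cases m) auto
  have "\<bar>tail_int ((tail_int ^^ k) (euler_stack m c f)) s - tail_int ((tail_int ^^ k) (euler_stack m c f)) t\<bar>
      \<le> M * \<bar>s - t\<bar>"
    by (intro tail_int_lipschitz tail_ints_continuous tail_ints_abs_le euler_stack_continuous_unit
          euler_stack_abs_le) (use assms in auto)
  moreover have "M \<ge> 0" using assms(3)[of 0] by simp
  then have "M * \<bar>s - t\<bar> * 1 \<le> M * \<bar>s - t\<bar> * 4 ^ m" by (intro mult_left_mono) auto
  ultimately show ?thesis
    by (simp add: green_def m divide_le_eq abs_divide flip: diff_divide_distrib)
qed

text \<open>The value at 0 carries the induction; after one averaging the result is positive up to
  and including \<open>t = 1\<close>, hence \<open>k \<ge> 1\<close>.\<close>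

lemma euler_stack_pos:
  assumes "continuous_on {0..1} f" "c > 1" "\<And>t. t \<in> {0..1} \<Longrightarrow> f t \<ge> 0" "f 0 > 0" "t \<in> {0..1}" "k \<ge> 1"
  shows "euler_stack k c f t > 0"
proof -
  have pos: "euler_stack (Suc k) c f t > 0" if "euler_stack k c f 0 > 0" "t \<in> {0..1}" for k t
    unfolding euler_stack.simps
    by (rule euler_inv_pos[OF euler_stack_continuous_unit[OF assms(1,2)] _ that(2) euler_stack_nonneg])
       (use assms that in simp_all)
  have 0: "euler_stack k c f 0 > 0" for k
  proof (induction k)
    case (Suc k)
    show ?case by (rule pos[OF Suc]) simp
  qed (use assms in simp)
  obtain j where "k = Suc j" using assms(6) by (cases k) auto
  then show ?thesis
    using pos[OF 0 assms(5), of j] by simp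
qed

lemma tail_ints_pos:
  assumes "continuous_on {0..1} f" "\<And>t. t \<in> {0..1} \<Longrightarrow> f t > 0" "t \<in> {0..<1}"
  shows "(tail_int ^^ k) f t > 0"
  using assms(3)
proof (induction k arbitrary: t)
  case (Suc k)
  show ?case unfolding funpow.simps o_apply
    by (rule tail_int_pos[OF tail_ints_continuous[OF assms(1)] _ tail_ints_nonneg])
       (use Suc assms(2) in \<open>simp_all add: less_imp_le\<close>)
qed (use assms in auto)

lemma green_pos:
  assumes "continuous_on {0..1} f" "c > 1" "\<And>t. t \<in> {0..1} \<Longrightarrow> f t \<ge> 0" "f 0 > 0" "t \<in> {0..<1}" "m \<ge> 1"
  shows "green m c f t > 0"
  unfolding green_def
  by (intro divide_pos_pos tail_ints_pos euler_stack_pos euler_stack_continuous_unit) (use assms in auto)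

section \<open>Bounds by negative powers of \<open>t\<close>\<close>

text \<open>The constant is chosen before \<open>f\<close> and \<open>C\<close>, so that it can be
  used uniformly along an infinite iteration.\<close>

lemma euler_stack_weighted_bound:
  assumes "c > 1" "d < c"
  shows "\<exists>K>0. \<forall>f C. continuous_on {0..1} f \<longrightarrow> (\<forall>t\<in>{0<..1}. \<bar>f t\<bar> \<le> C * t powr (- d)) \<longrightarrow>
     (\<forall>t\<in>{0<..1}. \<bar>euler_stack k c f t\<bar> \<le> K * C * t powr (- d))"
proof (induction k)
  case 0
  show ?case by (intro exI[of _ 1]) auto
next
  case (Suc k)
  then obtain K where K: "K > 0" "\<And>f C t. continuous_on {0..1} f \<Longrightarrow>
     (\<forall>t\<in>{0<..1}. \<bar>f t\<bar> \<le> C * t powr (- d)) \<Longrightarrow> t \<in> {0<..1} \<Longrightarrow>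
     \<bar>euler_stack k c f t\<bar> \<le> K * C * t powr (- d)" by blast
  show ?case
  proof (intro exI[of _ "K / (c + k - d)"] conjI allI impI ballI)
    fix f C t assume f: "continuous_on {0..1} f" "\<forall>t\<in>{0<..1}. \<bar>f t\<bar> \<le> C * t powr (- d)" "t \<in> {0<..1::real}"
    have "\<bar>euler_inv (c + k) (euler_stack k c f) t\<bar> \<le> K * C / (c + k - d) * t powr (- d)"
      by (rule euler_inv_weighted_bound) (use assms f K in \<open>auto intro!: euler_stack_continuous_unit\<close>)
    then show "\<bar>euler_stack (Suc k) c f t\<bar> \<le> K / (c + k - d) * C * t powr (- d)" by simp
  qed (use K assms in auto)
qed

lemma tail_ints_weighted_bound:
  assumes "h < 1" "\<And>j. j \<le> k \<Longrightarrow> 0 \<le> d - real j * h"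
  shows "\<exists>K>0. \<forall>f C. continuous_on {0..1} f \<longrightarrow> (\<forall>t\<in>{0<..1}. \<bar>f t\<bar> \<le> C * t powr (- d)) \<longrightarrow>
     (\<forall>t\<in>{0<..1}. \<bar>(tail_int ^^ k) f t\<bar> \<le> K * C * t powr (- (d - real k * h)))"
  using assms(2)
proof (induction k)
  case 0
  show ?case by (intro exI[of _ 1]) auto
next
  case (Suc k)
  then obtain K where K: "K > 0" "\<And>f C t. continuous_on {0..1} f \<Longrightarrow>
     (\<forall>t\<in>{0<..1}. \<bar>f t\<bar> \<le> C * t powr (- d)) \<Longrightarrow> t \<in> {0<..1} \<Longrightarrow>
     \<bar>(tail_int ^^ k) f t\<bar> \<le> K * C * t powr (- (d - real k * h))" by force
  let ?e = "d - real (Suc k) * h" and ?d = "d - real k * h"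
  have ed: "?e - ?d + 1 = 1 - h" by (simp add: algebra_simps)
  show ?case
  proof (intro exI[of _ "K / (1 - h)"] conjI allI impI ballI)
    fix f C t assume f: "continuous_on {0..1} f" "\<forall>t\<in>{0<..1}. \<bar>f t\<bar> \<le> C * t powr (- d)" "t \<in> {0<..1::real}"
    have "\<bar>tail_int ((tail_int ^^ k) f) t\<bar> \<le> K * C / (?e - ?d + 1) * t powr (- ?e)"
    proof (rule tail_int_weighted_bound)
      show "?d - 1 < ?e" using ed assms(1) by linarith
      show "0 \<le> ?e" using Suc.prems[of "Suc k"] by simp
    qed (use f K in \<open>auto intro!: tail_ints_continuous\<close>)
    then show "\<bar>(tail_int ^^ Suc k) f t\<bar> \<le> K / (1 - h) * C * t powr (- ?e)"
      unfolding ed by simp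
  qed (use K assms in auto)
qed

lemma green_weighted_bound:
  assumes "c > 1" "m \<ge> 1" "0 \<le> d" "d < c" "0 \<le> e" "d - real m < e"
  shows "\<exists>K>0. \<forall>f C. continuous_on {0..1} f \<longrightarrow> (\<forall>t\<in>{0<..1}. \<bar>f t\<bar> \<le> C * t powr (- d)) \<longrightarrow>
     (\<forall>t\<in>{0<..1}. \<bar>green m c f t\<bar> \<le> K * C * t powr (- e))"
proof -
  \<comment> \<open>The total change of exponent is shared equally by the \<open>m\<close>
    integrations, each of which can gain any amount below 1. The intermediate exponents interpolate
    between \<open>d\<close> and \<open>e\<close> and so stay nonnegative; \<open>h\<close> itself
    may be negative.\<close>
  define h where "h = (d - e) / real m"
  have mh: "real m * h = d - e" using assms(2) by (simp add: h_def)
  have h1: "h < 1" using assms by (simp add: h_def divide_less_eq)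
  have nn: "0 \<le> d - real j * h" if "j \<le> m" for j
  proof (cases "h \<ge> 0")
    case True
    then have "real j * h \<le> real m * h" using that by (intro mult_right_mono) auto
    then show ?thesis using mh assms by linarith
  next
    case False
    then have "real j * h \<le> 0" by (simp add: mult_le_0_iff)
    then show ?thesis using assms by linarith
  qed
  obtain K1 where K1: "K1 > 0" "\<And>f C t. continuous_on {0..1} f \<Longrightarrow>
     (\<forall>t\<in>{0<..1}. \<bar>f t\<bar> \<le> C * t powr (- d)) \<Longrightarrow> t \<in> {0<..1} \<Longrightarrow>
     \<bar>euler_stack m c f t\<bar> \<le> K1 * C * t powr (- d)"
    using euler_stack_weighted_bound[OF assms(1,4), of m] by blast
  obtain K2 where K2: "K2 > 0" "\<And>f C t. continuous_on {0..1} f \<Longrightarrow>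
     (\<forall>t\<in>{0<..1}. \<bar>f t\<bar> \<le> C * t powr (- d)) \<Longrightarrow> t \<in> {0<..1} \<Longrightarrow>
     \<bar>(tail_int ^^ m) f t\<bar> \<le> K2 * C * t powr (- (d - real m * h))"
    using tail_ints_weighted_bound[OF h1 nn, of m] by auto
  show ?thesis
  proof (intro exI[of _ "K2 * K1 / 4 ^ m"] conjI allI impI ballI)
    fix f C t assume f: "continuous_on {0..1} f" "\<forall>t\<in>{0<..1}. \<bar>f t\<bar> \<le> C * t powr (- d)" "t \<in> {0<..1::real}"
    have "\<bar>(tail_int ^^ m) (euler_stack m c f) t\<bar> \<le> K2 * (K1 * C) * t powr (- (d - real m * h))"
      by (rule K2(2)) (use f K1 assms in \<open>auto intro!: euler_stack_continuous_unit\<close>)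
    then show "\<bar>green m c f t\<bar> \<le> K2 * K1 / 4 ^ m * C * t powr (- e)"
      unfolding mh by (simp add: green_def field_simps)
  qed (use K1 K2 in auto)
qed

section \<open>Symmetry of the Green operator\<close>

definition head_int :: "(real \<Rightarrow> real) \<Rightarrow> real \<Rightarrow> real" where
  "head_int f t = integral {0..t} f"

lemma head_int_has_derivative:
  assumes "continuous_on {0..1} f" "t \<in> {0..1}"
  shows "(head_int f has_real_derivative f t) (at t within {0..1})"
  using integral_has_real_derivative[OF assms] by (simp add: head_int_def[abs_def])

lemma head_int_continuous:
  "continuous_on {0..1} f \<Longrightarrow> continuous_on {0..1} (head_int f)"
  using head_int_has_derivative DERIV_continuous
  by (fastforce simp: continuous_on_eq_continuous_within)

text \<open>Each head integral raises the power in the weight by one and applies the next inverse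
  Euler operator; this is why the parameters in \<open>euler_stack\<close> increase in unit
  steps.\<close>

lemma head_ints_eq_euler_stack:
  assumes "continuous_on {0..1} f" "c > 1" "t \<in> {0..1}"
  shows "(head_int ^^ k) (\<lambda>t. t powr (c - 1) * f t) t = t powr (c + real k - 1) * euler_stack k c f t"
  using assms(3)
proof (induction k arbitrary: t)
  case (Suc k)
  have "(head_int ^^ Suc k) (\<lambda>t. t powr (c - 1) * f t) t =
     integral {0..t} (\<lambda>t. t powr (c + real k - 1) * euler_stack k c f t)"
    unfolding funpow.simps o_apply head_int_def[of "(head_int ^^ k) _"]
    using Suc by (intro integral_cong) auto
  also have "\<dots> = t powr (c + real k) * euler_inv (c + real k) (euler_stack k c f) t"
    by (rule euler_inv_eq_integral[symmetric]) (use assms Suc in \<open>auto intro!: euler_stack_continuous_unit\<close>)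
  finally show ?case by simp
qed simp

text \<open>Integration by parts; one boundary term dies because \<open>head_int\<close> vanishes at
  0, the other because \<open>tail_int\<close> vanishes at 1.\<close>

lemma head_int_tail_int_adjoint:
  assumes a: "continuous_on {0..1} a" and b: "continuous_on {0..1} b"
  shows "integral {0..1} (\<lambda>t. a t * tail_int b t) = integral {0..1} (\<lambda>t. head_int a t * b t)"
proof -
  have "((\<lambda>t. a t * tail_int b t - head_int a t * b t) has_integral
      (head_int a 1 * tail_int b 1 - head_int a 0 * tail_int b 0)) {0..1}"
  proof (rule fundamental_theorem_of_calculus)
    fix t :: real assume t: "t \<in> {0..1}"
    have "((\<lambda>t. head_int a t * tail_int b t) has_real_derivative a t * tail_int b t - head_int a t * b t)
       (at t within {0..1})"
      using DERIV_mult[OF head_int_has_derivative[OF a t] tail_int_has_derivative[OF b t]]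
      by (simp add: algebra_simps)
    then show "((\<lambda>t. head_int a t * tail_int b t) has_vector_derivative a t * tail_int b t - head_int a t * b t)
       (at t within {0..1})"
      by (simp add: has_real_derivative_iff_has_vector_derivative)
  qed simp
  then have "integral {0..1} (\<lambda>t. a t * tail_int b t - head_int a t * b t) = 0"
    by (simp add: integral_unique head_int_def)
  moreover have "integral {0..1} (\<lambda>t. a t * tail_int b t - head_int a t * b t) =
     integral {0..1} (\<lambda>t. a t * tail_int b t) - integral {0..1} (\<lambda>t. head_int a t * b t)"
    by (intro integral_diff integrable_continuous_interval continuous_intros head_int_continuous
        tail_int_continuous a b)
  ultimately show ?thesis by simp
qed

lemma head_ints_tail_ints_adjoint:
  assumes "continuous_on {0..1} a" "continuous_on {0..1} b"
  shows "integral {0..1} (\<lambda>t. a t * (tail_int ^^ k) b t) = integral {0..1} (\<lambda>t. (head_int ^^ k) a t * b t)"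
  using assms(1)
proof (induction k arbitrary: a)
  case (Suc k)
  have "integral {0..1} (\<lambda>t. a t * (tail_int ^^ Suc k) b t) =
        integral {0..1} (\<lambda>t. head_int a t * (tail_int ^^ k) b t)"
    using head_int_tail_int_adjoint[OF Suc.prems tail_ints_continuous[OF assms(2)]] by simp
  also have "\<dots> = integral {0..1} (\<lambda>t. (head_int ^^ k) (head_int a) t * b t)"
    by (rule Suc.IH[OF head_int_continuous[OF Suc.prems]])
  finally show ?case by (simp add: funpow_swap1)
qed simp

text \<open>Moving all \<open>m\<close> tail integrals to the other factor turns it into the same
  Euler stack, so the right-hand side is visibly symmetric in \<open>f\<close> and \<open>g\<close>.
  Evaluation of \<open>euler_inv\<close> at 1 is the integral with weight
  \<open>t powr (c - 1)\<close>.\<close>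

lemma green_pairing:
  assumes "continuous_on {0..1} f" "continuous_on {0..1} g" "c > 1"
  shows "euler_inv c (\<lambda>t. g t * green m c f t) 1 =
     integral {0..1} (\<lambda>t. t powr (c + real m - 1) * (euler_stack m c g t * euler_stack m c f t)) / 4 ^ m"
proof -
  have "euler_inv c (\<lambda>t. g t * green m c f t) 1 =
     integral {0..1} (\<lambda>t. (t powr (c - 1) * g t) * (tail_int ^^ m) (euler_stack m c f) t) / 4 ^ m"
    unfolding euler_inv_def green_def by (simp add: mult_ac flip: integral_divide)
  also have "integral {0..1} (\<lambda>t. (t powr (c - 1) * g t) * (tail_int ^^ m) (euler_stack m c f) t) =
     integral {0..1} (\<lambda>t. (head_int ^^ m) (\<lambda>t. t powr (c - 1) * g t) t * euler_stack m c f t)"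
    by (intro head_ints_tail_ints_adjoint continuous_intros continuous_on_powr_unit
        euler_stack_continuous_unit assms)
  also have "\<dots> = integral {0..1} (\<lambda>t. t powr (c + real m - 1) * (euler_stack m c g t * euler_stack m c f t))"
    using assms by (intro integral_cong) (simp add: head_ints_eq_euler_stack)
  finally show ?thesis .
qed

lemma green_symmetric:
  assumes "continuous_on {0..1} f" "continuous_on {0..1} g" "c > 1"
  shows "euler_inv c (\<lambda>t. g t * green m c f t) 1 = euler_inv c (\<lambda>t. f t * green m c g t) 1"
  unfolding green_pairing[OF assms(1,2,3)] green_pairing[OF assms(2,1,3)] by (simp add: mult_ac)

section \<open>Levels of normalised profiles\<close>

text \<open>Strict convexity by the mean value theorem, with the strictly increasing derivative on
  either side of \<open>w\<close>. A vanishing \<open>x\<close> or \<open>w\<close> is handled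
  directly, as the derivative is used only at positive points.\<close>

lemma powr_tangent_less:
  fixes x w p :: real
  assumes "x \<ge> 0" "w \<ge> 0" "p > 0" "x \<noteq> w"
  shows "w powr (p + 1) + (p + 1) * w powr p * (x - w) < x powr (p + 1)"
proof -
  have eq: "w powr (p + 1) = w * w powr p" using powr_mult_base[of w p] assms by (simp add: add.commute)
  have der: "((\<lambda>x. x powr (p + 1)) has_real_derivative (p + 1) * z powr p) (at z)" if "z > 0" for z
    using has_real_derivative_powr[OF that, of "p + 1"] by simp
  consider "w = 0" | "w > 0" "x = 0" | "w > 0" "x > w" | "w > 0" "x > 0" "x < w"
    using assms by fastforce
  then show ?thesis
  proof cases
    case 2
    have "w powr (p + 1) - (p + 1) * w powr p * w = - p * (w * w powr p)" unfolding eq by (simp add: algebra_simps)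
    also have "\<dots> < 0" using 2 assms by simp
    finally show ?thesis using 2 assms by simp
  next
    case 3
    obtain z where z: "w < z" "z < x" "x powr (p + 1) - w powr (p + 1) = (x - w) * ((p + 1) * z powr p)"
      using MVT2[of w x "\<lambda>x. x powr (p + 1)" "\<lambda>z. (p + 1) * z powr p"] der 3 by force
    have "w powr p < z powr p" using z 3 assms by (intro powr_less_mono2) auto
    then have "(x - w) * ((p + 1) * w powr p) < (x - w) * ((p + 1) * z powr p)"
      using 3 assms by (intro mult_strict_left_mono) auto
    then show ?thesis using z(3) by (simp add: mult_ac)
  next
    case 4
    obtain z where z: "x < z" "z < w" "w powr (p + 1) - x powr (p + 1) = (w - x) * ((p + 1) * z powr p)"
      using MVT2[of x w "\<lambda>x. x powr (p + 1)" "\<lambda>z. (p + 1) * z powr p"] der 4 by force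
    have "z powr p < w powr p" using z 4 assms by (intro powr_less_mono2) auto
    then have "(w - x) * ((p + 1) * z powr p) < (w - x) * ((p + 1) * w powr p)"
      using 4 assms by (intro mult_strict_left_mono) auto
    then show ?thesis using z(3) by (simp add: algebra_simps)
  qed (use assms in auto)
qed

text \<open>With \<open>t = |x|^2\<close> and \<open>c = N / 2\<close>, the integral against \<open>t powr (c - 1)\<close> is, up to a constant,
  the Lebesgue integral of a radial function over the unit ball.\<close>

abbreviation radial_int :: "real \<Rightarrow> (real \<Rightarrow> real) \<Rightarrow> real" where
  "radial_int c f \<equiv> euler_inv c f 1"

lemma radial_int_mono:
  assumes "continuous_on {0..1} f" "continuous_on {0..1} g" "c > 1"
    "\<And>t. t \<in> {0..1} \<Longrightarrow> f t \<le> g t"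
  shows "radial_int c f \<le> radial_int c g"
  using euler_inv_nonneg[of "\<lambda>s. g s - f s" 1 c] euler_inv_diff[of g f c 1] assms by simp

text \<open>The point \<open>t = 0\<close> has to be left out because the weight vanishes
  there.\<close>

lemma radial_int_eqD:
  assumes f: "continuous_on {0..1} f" and g: "continuous_on {0..1} g" and c: "c > 1"
    and le: "\<And>t. t \<in> {0..1} \<Longrightarrow> f t \<le> g t" and eq: "radial_int c f = radial_int c g" and t: "t \<in> {0<..1}"
  shows "f t = g t"
proof -
  have cont: "continuous_on {0..1} (\<lambda>s. s powr (c - 1) * (g s - f s))"
    by (intro continuous_intros continuous_on_powr_unit f g c)
  have nn: "0 \<le> s powr (c - 1) * (g s - f s)" if "s \<in> {0..1}" for s using le that by simp
  have "integral {0..1} (\<lambda>s. s powr (c - 1) * (g s - f s)) = 0"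
    using euler_inv_diff[OF g f c, of 1] eq by (simp add: euler_inv_def)
  then have "\<forall>s\<in>{0..1}. s powr (c - 1) * (g s - f s) = 0"
    by (subst (asm) integral_eq_0_iff[OF cont _ nn]) auto
  from bspec[OF this, of t] t show ?thesis by simp
qed

text \<open>Recovers the point 0, about which weighted integrals and power bounds say nothing.
  Applied in both directions it yields equality.\<close>

lemma continuous_on_eq_unit:
  fixes f g :: "real \<Rightarrow> real"
  assumes "continuous_on {0..1} f" "continuous_on {0..1} g"
    "\<And>t. t \<in> {0<..1} \<Longrightarrow> f t \<le> g t" "t \<in> {0..1}"
  shows "f t \<le> g t"
  using continuous_le_on_closure[of "{0<..1}" "\<lambda>t. f t - g t" t 0] assms
  by (simp add: continuous_on_diff)

lemma continuous_on_powr_nonneg: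
  assumes "continuous_on S f" "\<And>t. t \<in> S \<Longrightarrow> f t \<ge> (0::real)" "p > 0"
  shows "continuous_on S (\<lambda>t. f t powr p)"
  by (intro continuous_on_powr') (use assms in \<open>auto intro: continuous_intros\<close>)

text \<open>Decreasing radial functions on the unit sphere of the weighted
  \<open>(p + 1)\<close>-norm.\<close>

definition profile :: "real \<Rightarrow> real \<Rightarrow> (real \<Rightarrow> real) \<Rightarrow> bool" where
  "profile c p w \<longleftrightarrow> continuous_on {0..1} w \<and> (\<forall>t\<in>{0..1}. 0 \<le> w t) \<and>
     (\<forall>s t. 0 \<le> s \<longrightarrow> s \<le> t \<longrightarrow> t \<le> 1 \<longrightarrow> w t \<le> w s) \<and> radial_int c (\<lambda>t. w t powr (p + 1)) = 1"

lemma profileD: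
  assumes "profile c p w"
  shows "continuous_on {0..1} w" "t \<in> {0..1} \<Longrightarrow> 0 \<le> w t"
    "0 \<le> s \<Longrightarrow> s \<le> t \<Longrightarrow> t \<le> 1 \<Longrightarrow> w t \<le> w s" "radial_int c (\<lambda>t. w t powr (p + 1)) = 1"
  using assms by (auto simp: profile_def)

lemma profile_pos_0:
  assumes "profile c p w" "p > 0"
  shows "w 0 > 0"
proof (rule ccontr)
  assume "\<not> ?thesis"
  then have "w t = 0" if "t \<in> {0..1}" for t
    using profileD(2)[OF assms(1) that] profileD(3)[OF assms(1), of 0 t] that by auto
  then have "radial_int c (\<lambda>t. w t powr (p + 1)) = radial_int c (\<lambda>t. 0)"
    by (intro euler_inv_cong) auto
  then show False using profileD(4)[OF assms(1)] by (simp add: euler_inv_def)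
qed

text \<open>A radial lemma of Strauss type: by monotonicity the mass on \<open>{0..t}\<close> is at
  least \<open>w t powr (p + 1) * t powr c / c\<close>, and the total mass is 1.\<close>

lemma profile_bound:
  assumes w: "profile c p w" and c: "c > 1" and p: "p > 0" and t: "t \<in> {0<..1}"
  shows "w t \<le> c powr (1 / (p + 1)) * t powr (- (c / (p + 1)))"
proof -
  have t1: "t \<in> {0..1}" and wt: "w t \<ge> 0" using t profileD(2)[OF w] by auto
  have cont: "continuous_on {0..1} (\<lambda>s. w s powr (p + 1))"
    by (rule continuous_on_powr_nonneg) (use profileD[OF w] p in auto)
  have cont': "continuous_on {0..1} (\<lambda>s. s powr (c - 1) * w s powr (p + 1))"
    by (intro continuous_intros continuous_on_powr_unit cont c)
  have sub: "{0..t} \<subseteq> {0..1}" using t by auto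
  have "w t powr (p + 1) * (t powr c / c) = integral {0..t} (\<lambda>s. w t powr (p + 1) * s powr (c - 1))"
    using has_integral_powr_from_0[of "c - 1" t] c t by (simp add: integral_unique)
  also have "\<dots> \<le> integral {0..t} (\<lambda>s. s powr (c - 1) * w s powr (p + 1))"
  proof (rule integral_le)
    show "(\<lambda>s. w t powr (p + 1) * s powr (c - 1)) integrable_on {0..t}"
      by (intro integrable_continuous_interval continuous_intros
          continuous_on_subset[OF continuous_on_powr_unit[OF c] sub])
    show "(\<lambda>s. s powr (c - 1) * w s powr (p + 1)) integrable_on {0..t}"
      by (intro integrable_continuous_interval continuous_on_subset[OF cont' sub])
    fix s assume s: "s \<in> {0..t}"
    have "w t powr (p + 1) \<le> w s powr (p + 1)"
      by (rule powr_mono2) (use profileD(3)[OF w, of s t] s t p wt in auto)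
    then show "w t powr (p + 1) * s powr (c - 1) \<le> s powr (c - 1) * w s powr (p + 1)"
      by (simp add: mult.commute mult_left_mono)
  qed
  also have "\<dots> \<le> integral {0..1} (\<lambda>s. s powr (c - 1) * w s powr (p + 1))"
    by (rule integral_subset_le[OF sub])
       (auto intro!: integrable_continuous_interval continuous_on_subset[OF cont' sub] cont')
  also have "\<dots> = 1" using profileD(4)[OF w] by (simp add: euler_inv_def)
  finally have "w t powr (p + 1) \<le> c * t powr (- c)"
    using t c by (simp add: powr_minus field_simps)
  then have "(w t powr (p + 1)) powr (1 / (p + 1)) \<le> (c * t powr (- c)) powr (1 / (p + 1))"
    using p by (intro powr_mono2) auto
  then show ?thesis using p c wt by (simp add: powr_powr powr_mult)
qed

text \<open>The weighted \<open>(q + 1)\<close>-norm of the Green potential of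
  \<open>w powr p\<close>. By Hoelder duality it is the largest pairing of that potential with
  \<open>z powr q\<close> over normalised \<open>z\<close>, attained at
  \<open>half_step\<close>.\<close>

definition level :: "nat \<Rightarrow> real \<Rightarrow> real \<Rightarrow> real \<Rightarrow> (real \<Rightarrow> real) \<Rightarrow> real" where
  "level m c p q w =
     radial_int c (\<lambda>t. green m c (\<lambda>s. w s powr p) t powr (q + 1)) powr (1 / (q + 1))"

definition half_step :: "nat \<Rightarrow> real \<Rightarrow> real \<Rightarrow> real \<Rightarrow> (real \<Rightarrow> real) \<Rightarrow> real \<Rightarrow> real" where
  "half_step m c p q w t = green m c (\<lambda>s. w s powr p) t / level m c p q w"

lemma profile_powr_continuous:
  "profile c p w \<Longrightarrow> r > 0 \<Longrightarrow> continuous_on {0..1} (\<lambda>t. w t powr r)"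
  by (rule continuous_on_powr_nonneg) (auto simp: profile_def)

context
  fixes m :: nat and c :: real
  assumes m: "m \<ge> 1" and c: "c > 1"
begin

lemma green_profile_nonneg: "t \<in> {0..1} \<Longrightarrow> green m c (\<lambda>s. w s powr p) t \<ge> 0"
  by (rule green_nonneg) auto

lemma green_profile_continuous:
  "profile c p w \<Longrightarrow> p > 0 \<Longrightarrow> continuous_on {0..1} (green m c (\<lambda>s. w s powr p))"
  by (intro green_continuous profile_powr_continuous c)

lemma green_profile_powr_continuous:
  "profile c p w \<Longrightarrow> p > 0 \<Longrightarrow> r > 0 \<Longrightarrow> continuous_on {0..1} (\<lambda>t. green m c (\<lambda>s. w s powr p) t powr r)"
  by (rule continuous_on_powr_nonneg) (auto intro: green_profile_continuous green_profile_nonneg)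

lemma green_profile_pos:
  assumes "profile c p w" "p > 0" "t \<in> {0..<1}"
  shows "green m c (\<lambda>s. w s powr p) t > 0"
  using profile_pos_0[OF assms(1,2)]
  by (intro green_pos profile_powr_continuous[OF assms(1,2)] c m assms) auto

lemma level_pos:
  assumes "profile c p w" "p > 0" "q > 0"
  shows "level m c p q w > 0"
proof -
  have "radial_int c (\<lambda>t. green m c (\<lambda>s. w s powr p) t powr (q + 1)) > 0"
    using green_profile_pos[OF assms(1,2), of 0]
    by (intro euler_inv_pos green_profile_powr_continuous c assms) (use assms in auto)
  then show ?thesis by (simp add: level_def)
qed

lemma level_powr:
  assumes "profile c p w" "p > 0" "q > 0"
  shows "level m c p q w powr (q + 1) = radial_int c (\<lambda>t. green m c (\<lambda>s. w s powr p) t powr (q + 1))"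
proof -
  have "radial_int c (\<lambda>t. green m c (\<lambda>s. w s powr p) t powr (q + 1)) \<ge> 0"
    by (rule euler_inv_nonneg) auto
  then show ?thesis using assms by (simp add: level_def powr_powr)
qed

lemma half_step_profile:
  assumes w: "profile c p w" and "p > 0" "q > 0"
  shows "profile c q (half_step m c p q w)"
  unfolding profile_def
proof (intro conjI allI impI ballI)
  let ?l = "level m c p q w" and ?v = "green m c (\<lambda>s. w s powr p)"
  note l = level_pos[OF assms]
  show "continuous_on {0..1} (half_step m c p q w)"
    unfolding half_step_def[abs_def] using l
    by (intro continuous_intros green_profile_continuous assms) auto
  show "0 \<le> half_step m c p q w t" if "t \<in> {0..1}" for t
    using green_profile_nonneg[OF that] l by (simp add: half_step_def)
  show "half_step m c p q w t \<le> half_step m c p q w s" if "0 \<le> s" "s \<le> t" "t \<le> 1" for s t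
    unfolding half_step_def using l that
    by (intro divide_right_mono green_antimono profile_powr_continuous[OF w] assms c m) auto
  have "radial_int c (\<lambda>t. half_step m c p q w t powr (q + 1)) =
        radial_int c (\<lambda>t. (1 / ?l powr (q + 1)) * (?v t powr (q + 1)))"
    by (rule euler_inv_cong)
       (use l green_profile_nonneg in \<open>auto simp: half_step_def powr_divide\<close>)
  also have "\<dots> = 1"
    using l by (simp only: euler_inv_cmult level_powr[OF assms, symmetric]) simp
  finally show "radial_int c (\<lambda>t. half_step m c p q w t powr (q + 1)) = 1" .
qed

lemma green_eq_half_step:
  assumes "profile c p w" "p > 0" "q > 0"
  shows "green m c (\<lambda>s. w s powr p) t = level m c p q w * half_step m c p q w t"
  using level_pos[OF assms] by (simp add: half_step_def)

text \<open>Both levels are values of the same symmetric pairing, which the tangent inequality for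
  \<open>x powr (p + 1)\<close> bounds by the larger one (it replaces Hoelder's inequality and its equality case).\<close>

lemma level_le:
  assumes w: "profile c p w" and p: "p > 0" and q: "q > 0"
  defines "z \<equiv> half_step m c p q w"
  shows "level m c p q w \<le> level m c q p z"
    and "level m c p q w = level m c q p z \<Longrightarrow> t \<in> {0..1} \<Longrightarrow> half_step m c q p z t = w t"
proof -
  let ?l = "level m c p q w" and ?m = "level m c q p z"
  define x where "x = half_step m c q p z"
  have z: "profile c q z" unfolding z_def by (rule half_step_profile[OF w p q])
  have x: "profile c p x" unfolding x_def by (rule half_step_profile[OF z q p])
  have l: "?l > 0" by (rule level_pos[OF w p q])
  have mu: "?m > 0" by (rule level_pos[OF z q p])
  have cw: "continuous_on {0..1} (\<lambda>t. w t powr (p + 1))" "continuous_on {0..1} (\<lambda>t. w t powr p)"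
    using profile_powr_continuous[OF w] p by auto
  have cx: "continuous_on {0..1} (\<lambda>t. x t powr (p + 1))" "continuous_on {0..1} x"
    using profile_powr_continuous[OF x, of "p + 1"] p profileD(1)[OF x] by auto
  \<comment> \<open>By the normalisation of \<open>z\<close>, the first level is the pairing of
    \<open>z powr q\<close> with the potential of \<open>w powr p\<close>. Moving the Green operator
    to the other factor turns it into the second level times the integral of
    \<open>w powr p * x\<close>, and only that integral remains to be bounded by 1.\<close>
  have "?l = radial_int c (\<lambda>t. ?l * z t powr (q + 1))"
    using profileD(4)[OF z] by (simp add: euler_inv_cmult)
  also have "\<dots> = radial_int c (\<lambda>t. z t powr q * green m c (\<lambda>s. w s powr p) t)"
  proof (rule euler_inv_cong)
    fix t :: real assume t: "t \<in> {0..1}"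
    have "z t powr (q + 1) = z t * z t powr q"
      using powr_mult_base[OF profileD(2)[OF z t], of q] by (simp add: add.commute)
    then show "?l * z t powr (q + 1) = z t powr q * green m c (\<lambda>s. w s powr p) t"
      by (simp add: green_eq_half_step[OF w p q] z_def)
  qed simp
  also have "\<dots> = radial_int c (\<lambda>t. w t powr p * green m c (\<lambda>s. z s powr q) t)"
    by (rule green_symmetric) (use profile_powr_continuous w z p q c in auto)
  also have "\<dots> = radial_int c (\<lambda>t. ?m * (w t powr p * x t))"
    by (rule euler_inv_cong) (auto simp: green_eq_half_step[OF z q p] x_def)
  also have "\<dots> = ?m * radial_int c (\<lambda>t. w t powr p * x t)" by (rule euler_inv_cmult)
  finally have lm: "?l = ?m * radial_int c (\<lambda>t. w t powr p * x t)" .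
  \<comment> \<open>The tangent of the convex power at \<open>w t\<close>, taken at
    \<open>x t\<close>. As \<open>w\<close> and \<open>x\<close> have the same normalisation,
    integrating \<open>h \<le> x powr (p + 1)\<close> leaves precisely the bound by 1.\<close>
  define h where "h = (\<lambda>t. w t powr (p + 1) + (p + 1) * w t powr p * (x t - w t))"
  have ch: "continuous_on {0..1} h"
    unfolding h_def by (intro continuous_intros cw cx profileD(1)[OF w])
  have h_less: "h t < x t powr (p + 1)" if "t \<in> {0..1}" "x t \<noteq> w t" for t
    unfolding h_def using powr_tangent_less[of "x t" "w t" p] profileD(2)[OF x] profileD(2)[OF w] that p by simp
  have h_le: "h t \<le> x t powr (p + 1)" if "t \<in> {0..1}" for t
    using h_less[OF that] that by (cases "x t = w t") (auto simp: h_def)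
  have ih: "radial_int c h = (p + 1) * radial_int c (\<lambda>t. w t powr p * x t) - p"
  proof -
    have "radial_int c h = radial_int c (\<lambda>t. (p + 1) * (w t powr p * x t) - p * w t powr (p + 1))"
    proof (rule euler_inv_cong)
      fix t :: real assume t: "t \<in> {0..1}"
      have "w t powr (p + 1) = w t * w t powr p"
        using powr_mult_base[OF profileD(2)[OF w t], of p] by (simp add: add.commute)
      then show "h t = (p + 1) * (w t powr p * x t) - p * w t powr (p + 1)"
        unfolding h_def by (simp add: algebra_simps)
    qed simp
    also have "\<dots> = radial_int c (\<lambda>t. (p + 1) * (w t powr p * x t)) - radial_int c (\<lambda>t. p * w t powr (p + 1))"
      by (rule euler_inv_diff) (intro continuous_intros cw cx | use c in simp)+
    finally show ?thesis by (simp only: euler_inv_cmult profileD(4)[OF w] mult_1_right)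
  qed
  have "radial_int c h \<le> radial_int c (\<lambda>t. x t powr (p + 1))"
    by (rule radial_int_mono[OF ch cx(1) c h_le])
  then have "(p + 1) * radial_int c (\<lambda>t. w t powr p * x t) \<le> (p + 1) * 1"
    using ih profileD(4)[OF x] by simp
  then have le1: "radial_int c (\<lambda>t. w t powr p * x t) \<le> 1"
    using p by (simp add: mult_le_cancel_left_pos)
  then have "?m * radial_int c (\<lambda>t. w t powr p * x t) \<le> ?m * 1" using mu by (intro mult_left_mono) auto
  with lm show "?l \<le> ?m" by simp
  \<comment> \<open>Equal levels make the integrated tangent inequality an equality, hence a
    pointwise one for \<open>t > 0\<close>; strictness then forces \<open>x = w\<close>, and
    continuity adds \<open>t = 0\<close>.\<close>
  assume eq: "?l = ?m" and t: "t \<in> {0..1}"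
  have "radial_int c (\<lambda>t. w t powr p * x t) = 1" using lm eq mu by simp
  then have "radial_int c h = radial_int c (\<lambda>t. x t powr (p + 1))"
    using ih profileD(4)[OF x] by simp
  from radial_int_eqD[OF ch cx(1) c h_le this] have "h s = x s powr (p + 1)" if "s \<in> {0<..1}" for s
    using that by blast
  then have xw: "x s = w s" if "s \<in> {0<..1}" for s
    using h_less[of s] that by fastforce
  show "half_step m c q p z t = w t"
    using continuous_on_eq_unit[OF cx(2) profileD(1)[OF w] _ t]
      continuous_on_eq_unit[OF profileD(1)[OF w] cx(2) _ t] xw
    by (force simp: x_def)
qed

end

section \<open>Nonlinear power iteration\<close>

lemma uniform_limit_radial_int:
  assumes "uniform_limit {0..1} F g sequentially" "\<And>n. continuous_on {0..1} (F n)"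
    "continuous_on {0..1} g" "c > 1"
  shows "(\<lambda>n. radial_int c (F n)) \<longlonglongrightarrow> radial_int c g"
proof (rule tendstoI)
  fix e :: real assume "e > 0"
  then have "\<forall>\<^sub>F n in sequentially. \<forall>x\<in>{0..1}. dist (F n x) (g x) < e / 2"
    by (intro uniform_limitD[OF assms(1)]) simp
  then show "\<forall>\<^sub>F n in sequentially. dist (radial_int c (F n)) (radial_int c g) < e"
  proof eventually_elim
    case (elim n)
    have "\<bar>radial_int c (\<lambda>t. F n t - g t)\<bar> \<le> e / 2"
      using elim assms by (intro euler_inv_abs_le) (auto simp: dist_real_def less_imp_le intro: continuous_intros)
    then show ?case using \<open>e > 0\<close> assms by (simp add: euler_inv_diff dist_real_def)
  qed
qed

lemma uniform_limit_green:
  assumes "uniform_limit {0..1} F g sequentially" "\<And>n. continuous_on {0..1} (F n)"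
    "continuous_on {0..1} g" "c > 1"
  shows "uniform_limit {0..1} (\<lambda>n. green m c (F n)) (green m c g) sequentially"
proof (rule uniform_limitI)
  fix e :: real assume "e > 0"
  then have "\<forall>\<^sub>F n in sequentially. \<forall>x\<in>{0..1}. dist (F n x) (g x) < e / 2"
    by (intro uniform_limitD[OF assms(1)]) simp
  then show "\<forall>\<^sub>F n in sequentially. \<forall>x\<in>{0..1}. dist (green m c (F n) x) (green m c g x) < e"
  proof eventually_elim
    case (elim n)
    show ?case
    proof
      fix t :: real assume t: "t \<in> {0..1}"
      have "\<bar>green m c (F n) t - green m c g t\<bar> \<le> e / 2"
        by (rule green_dist_le[OF assms(2-4) t]) (use elim in \<open>auto simp: dist_real_def less_imp_le\<close>)
      then show "dist (green m c (F n) t) (green m c g t) < e" using \<open>e > 0\<close> by (simp add: dist_real_def)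
    qed
  qed
qed

lemma uniform_limit_powr:
  fixes F :: "nat \<Rightarrow> real \<Rightarrow> real"
  assumes "uniform_limit {0..1} F g sequentially" "\<And>n t. t \<in> {0..1} \<Longrightarrow> 0 \<le> F n t \<and> F n t \<le> C" "p > 0"
  shows "uniform_limit {0..1} (\<lambda>n t. F n t powr p) (\<lambda>t. g t powr p) sequentially"
proof (rule uniform_limit_compose_uniformly_continuous_on[OF assms(1), of "{0..C}"])
  show "uniformly_continuous_on {0..C} (\<lambda>x. x powr p)"
    by (rule compact_uniformly_continuous[OF continuous_on_powr_nonneg])
       (use assms(3) in \<open>auto intro!: continuous_intros\<close>)
qed (use assms in auto)

lemma profile_uniform_limit:
  assumes lim: "uniform_limit {0..1} F g sequentially" and F: "\<And>n. profile c p (F n)"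
    and C: "\<And>n t. t \<in> {0..1} \<Longrightarrow> F n t \<le> C" and "p > 0" "c > 1"
  shows "profile c p g"
proof -
  have ptw: "(\<lambda>n. F n t) \<longlonglongrightarrow> g t" if "t \<in> {0..1}" for t
    using tendsto_uniform_limitI[OF lim that] .
  have cont: "continuous_on {0..1} g"
    by (rule uniform_limit_theorem[OF _ lim]) (use F in \<open>auto simp: profile_def\<close>)
  have nn: "0 \<le> g t" if "t \<in> {0..1}" for t
    by (rule LIMSEQ_le_const[OF ptw[OF that]]) (use profileD(2)[OF F that] in auto)
  have cp: "continuous_on {0..1} (\<lambda>t. g t powr (p + 1))"
    by (rule continuous_on_powr_nonneg) (use cont nn assms in auto)
  have "(\<lambda>n. radial_int c (\<lambda>t. F n t powr (p + 1))) \<longlonglongrightarrow> radial_int c (\<lambda>t. g t powr (p + 1))"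
    by (rule uniform_limit_radial_int[OF uniform_limit_powr[OF lim, of C] profile_powr_continuous[OF F] cp])
       (use C profileD(2)[OF F] assms in auto)
  then have "radial_int c (\<lambda>t. g t powr (p + 1)) = 1"
    using profileD(4)[OF F] by (simp add: LIMSEQ_const_iff)
  moreover have "g t \<le> g s" if "0 \<le> s" "s \<le> t" "t \<le> 1" for s t
    by (rule LIMSEQ_le[OF ptw ptw]) (use profileD(3)[OF F that] that in auto)
  ultimately show ?thesis using cont nn by (auto simp: profile_def)
qed

context
  fixes m :: nat and c :: real
  assumes m: "m \<ge> 1" and c: "c > 1"
begin

text \<open>One round of the bootstrap. Normalising divides by the level, so a lower bound
  \<open>l\<close> for it enters the estimate; \<open>K\<close> depends on neither \<open>w\<close>
  nor \<open>l\<close> nor \<open>C\<close>.\<close>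

lemma half_step_bound:
  assumes "0 \<le> A" "p * A < c" "0 \<le> e" "p * A - real m < e" "p > 0" "q > 0"
  shows "\<exists>K>0. \<forall>w l C. profile c p w \<longrightarrow> 0 < l \<longrightarrow> l \<le> level m c p q w \<longrightarrow> 0 \<le> C \<longrightarrow>
    (\<forall>t\<in>{0<..1}. w t \<le> C * t powr (- A)) \<longrightarrow>
    (\<forall>t\<in>{0<..1}. half_step m c p q w t \<le> K * C powr p / l * t powr (- e))"
proof -
  obtain K where K: "K > 0" "\<And>f C t. continuous_on {0..1} f \<Longrightarrow>
     (\<forall>t\<in>{0<..1}. \<bar>f t\<bar> \<le> C * t powr (- (p * A))) \<Longrightarrow> t \<in> {0<..1} \<Longrightarrow>
     \<bar>green m c f t\<bar> \<le> K * C * t powr (- e)"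
    using green_weighted_bound[OF c m _ assms(2,3,4)] assms by (metis mult_nonneg_nonneg less_imp_le)
  show ?thesis
  proof (intro exI[of _ K] conjI allI impI ballI)
    fix w l C t assume w: "profile c p w" and l: "0 < l" "l \<le> level m c p q w" and C: "0 \<le> C"
      "\<forall>t\<in>{0<..1}. w t \<le> C * t powr (- A)" and t: "t \<in> {0<..1::real}"
    have "\<bar>green m c (\<lambda>s. w s powr p) t\<bar> \<le> K * (C powr p) * t powr (- e)"
    proof (rule K(2)[OF profile_powr_continuous[OF w \<open>p > 0\<close>] _ t], intro ballI)
      fix s :: real assume s: "s \<in> {0<..1}"
      have "w s powr p \<le> (C * s powr (- A)) powr p"
        by (rule powr_mono2) (use s C assms profileD(2)[OF w, of s] in auto)
      also have "\<dots> = C powr p * s powr (- (p * A))"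
        using C s by (simp add: powr_mult powr_powr mult.commute)
      finally show "\<bar>w s powr p\<bar> \<le> C powr p * s powr (- (p * A))" by simp
    qed
    then have le: "green m c (\<lambda>s. w s powr p) t \<le> K * (C powr p) * t powr (- e)" by simp
    have "half_step m c p q w t \<le> K * (C powr p) * t powr (- e) / level m c p q w"
      unfolding half_step_def using le l by (intro divide_right_mono) auto
    also have "\<dots> \<le> K * (C powr p) * t powr (- e) / l"
      using K l by (intro divide_left_mono) auto
    finally show "half_step m c p q w t \<le> K * C powr p / l * t powr (- e)" by simp
  qed (use K in auto)
qed

text \<open>A crude sup estimate; its purpose is to make the increasing sequence of levels
  converge.\<close>

lemma level_le_bound:
  assumes w: "profile c p w" and C: "\<And>t. t \<in> {0..1} \<Longrightarrow> w t \<le> C" and p: "p > 0" and q: "q > 0"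
  shows "level m c p q w \<le> C powr p"
proof -
  have nn: "radial_int c (\<lambda>t. green m c (\<lambda>s. w s powr p) t powr (q + 1)) \<ge> 0"
    by (rule euler_inv_nonneg) auto
  have g: "\<bar>green m c (\<lambda>s. w s powr p) t\<bar> \<le> C powr p" if "t \<in> {0..1}" for t
    by (rule green_abs_le[OF profile_powr_continuous[OF w p] c _ that])
       (use C profileD(2)[OF w] p in \<open>auto intro!: powr_mono2\<close>)
  have "\<bar>radial_int c (\<lambda>t. green m c (\<lambda>s. w s powr p) t powr (q + 1))\<bar> \<le> (C powr p) powr (q + 1)"
    by (rule euler_inv_abs_le[OF green_profile_powr_continuous[OF m c w p] c])
       (use g green_profile_nonneg[OF m c] q in \<open>auto intro!: powr_mono2\<close>)
  then have "level m c p q w \<le> ((C powr p) powr (q + 1)) powr (1 / (q + 1))"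
    unfolding level_def using nn q by (intro powr_mono2) auto
  also have "\<dots> = C powr p" using q by (simp add: powr_powr)
  finally show ?thesis .
qed

text \<open>The limit is again a normalised profile, so its level is positive; this is what permits
  the root and the division in the limit.\<close>

lemma half_step_uniform_limit:
  assumes lim: "uniform_limit {0..1} F g sequentially" and F: "\<And>n. profile c p (F n)"
    and C: "\<And>n t. t \<in> {0..1} \<Longrightarrow> F n t \<le> C" and p: "p > 0" and q: "q > 0"
  shows "(\<lambda>n. level m c p q (F n)) \<longlonglongrightarrow> level m c p q g"
    and "uniform_limit {0..1} (\<lambda>n. half_step m c p q (F n)) (half_step m c p q g) sequentially"
proof -
  have g: "profile c p g" by (rule profile_uniform_limit[OF lim F C p c])
  have bd: "0 \<le> F n t \<and> F n t \<le> C" if "t \<in> {0..1}" for n t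
    using C[OF that] profileD(2)[OF F that] by auto
  have ul: "uniform_limit {0..1} (\<lambda>n. green m c (\<lambda>s. F n s powr p)) (green m c (\<lambda>s. g s powr p)) sequentially"
    by (intro uniform_limit_green uniform_limit_powr[OF lim bd p] profile_powr_continuous[OF F p]
        profile_powr_continuous[OF g p] c)
  have gbd: "0 \<le> green m c (\<lambda>s. F n s powr p) t \<and> green m c (\<lambda>s. F n s powr p) t \<le> C powr p"
    if t: "t \<in> {0..1}" for n t
  proof
    show "0 \<le> green m c (\<lambda>s. F n s powr p) t" by (rule green_profile_nonneg[OF m c t])
    have "\<bar>green m c (\<lambda>s. F n s powr p) t\<bar> \<le> C powr p"
      by (rule green_abs_le[OF profile_powr_continuous[OF F p] c _ t])
         (use bd p in \<open>auto intro!: powr_mono2\<close>)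
    then show "green m c (\<lambda>s. F n s powr p) t \<le> C powr p" by simp
  qed
  have "(\<lambda>n. radial_int c (\<lambda>t. green m c (\<lambda>s. F n s powr p) t powr (q + 1)))
      \<longlonglongrightarrow> radial_int c (\<lambda>t. green m c (\<lambda>s. g s powr p) t powr (q + 1))"
    by (rule uniform_limit_radial_int[OF uniform_limit_powr[OF ul gbd]
          green_profile_powr_continuous[OF m c F p] green_profile_powr_continuous[OF m c g p] c])
       (use q in auto)
  moreover have "radial_int c (\<lambda>t. green m c (\<lambda>s. g s powr p) t powr (q + 1)) \<noteq> 0"
    using level_powr[OF m c g p q] level_pos[OF m c g p q] by auto
  ultimately show lev: "(\<lambda>n. level m c p q (F n)) \<longlonglongrightarrow> level m c p q g"
    unfolding level_def by (intro tendsto_powr tendsto_const)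
  have "(\<lambda>n. 1 / level m c p q (F n)) \<longlonglongrightarrow> 1 / level m c p q g"
    using level_pos[OF m c g p q] by (intro tendsto_intros lev) auto
  then have "uniform_limit {0..1::real} (\<lambda>n t. 1 / level m c p q (F n)) (\<lambda>t. 1 / level m c p q g) sequentially"
    by (auto simp: uniform_limit_iff tendsto_iff elim!: eventually_mono)
  then have "uniform_limit {0..1} (\<lambda>n t. green m c (\<lambda>s. F n s powr p) t * (1 / level m c p q (F n)))
      (\<lambda>t. green m c (\<lambda>s. g s powr p) t * (1 / level m c p q g)) sequentially"
    by (intro uniform_lim_mult[OF ul])
       (auto intro!: compact_imp_bounded compact_continuous_image green_profile_continuous[OF m c g p])
  then show "uniform_limit {0..1} (\<lambda>n. half_step m c p q (F n)) (half_step m c p q g) sequentially"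
    by (simp add: half_step_def[abs_def])
qed

lemma half_step_lipschitz:
  assumes w: "profile c p w" and C: "\<And>t. t \<in> {0..1} \<Longrightarrow> w t \<le> C" and p: "p > 0"
    and l: "0 < l" "l \<le> level m c p q w" and st: "s \<in> {0..1}" "t \<in> {0..1}"
  shows "\<bar>half_step m c p q w s - half_step m c p q w t\<bar> \<le> C powr p / l * \<bar>s - t\<bar>"
proof -
  have "\<bar>green m c (\<lambda>s. w s powr p) s - green m c (\<lambda>s. w s powr p) t\<bar> \<le> C powr p * \<bar>s - t\<bar>"
    by (rule green_lipschitz[OF profile_powr_continuous[OF w p] c _ st m])
       (use C profileD(2)[OF w] p in \<open>auto intro!: powr_mono2\<close>)
  then have "\<bar>half_step m c p q w s - half_step m c p q w t\<bar> \<le> C powr p * \<bar>s - t\<bar> / level m c p q w"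
    unfolding half_step_def using l by (simp add: divide_right_mono flip: diff_divide_distrib)
  also have "\<dots> \<le> C powr p * \<bar>s - t\<bar> / l" using l by (intro divide_left_mono) auto
  finally show ?thesis by simp
qed

text \<open>The levels of the two half steps interlace and so have a common limit. At a uniform
  limit point of the iterates both levels equal it, which is the equality case of
  \<open>level_le\<close> and gives a fixed point. The work lies in compactness, that is, in a
  uniform bound for late iterates.\<close>

lemma fixed_profiles:
  assumes p: "p \<ge> 1" and q: "q \<ge> 1" and sub: "c / (p + 1) + c / (q + 1) > c - real m"
  shows "\<exists>w z l. l > 0 \<and> profile c p w \<and> profile c q z \<and>
    (\<forall>t\<in>{0..1}. green m c (\<lambda>s. w s powr p) t = l * z t \<and> green m c (\<lambda>s. z s powr q) t = l * w t)"
proof -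
  have p0: "p > 0" and q0: "q > 0" using p q by auto
  \<comment> \<open>The constant start is normalised because the weight has integral
    \<open>1 / c\<close>.\<close>
  define W where "W n = ((\<lambda>w. half_step m c q p (half_step m c p q w)) ^^ n) (\<lambda>t. c powr (1 / (p + 1)))" for n
  define Z where "Z n = half_step m c p q (W n)" for n
  have W_Suc: "W (Suc n) = half_step m c q p (Z n)" for n by (simp add: W_def Z_def)
  have W0: "profile c p (W 0)"
    unfolding profile_def W_def using c p0
    by (simp add: powr_powr) (use integral_powr_unit[of c] in \<open>simp add: euler_inv_def\<close>)
  have W: "profile c p (W n)" for n
  proof (induction n)
    case (Suc n)
    then show ?case unfolding W_Suc Z_def by (intro half_step_profile[OF m c] p0 q0)
  qed (rule W0)
  have Z: "profile c q (Z n)" for n unfolding Z_def by (rule half_step_profile[OF m c W p0 q0])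
  define L where "L n = level m c p q (W n)" for n
  define M where "M n = level m c q p (Z n)" for n
  have L_le_M: "L n \<le> M n" for n unfolding L_def M_def Z_def by (rule level_le(1)[OF m c W p0 q0])
  have M_le_L: "M n \<le> L (Suc n)" for n
    unfolding L_def M_def W_Suc by (rule level_le(1)[OF m c Z q0 p0])
  have incL: "incseq L" by (rule incseq_SucI) (use L_le_M M_le_L order_trans in blast)
  \<comment> \<open>Levels increase, so the first one bounds every later normalising factor from
    below.\<close>
  define l where "l = L 0"
  have l: "l > 0" unfolding l_def L_def by (rule level_pos[OF m c W p0 q0])
  have lL: "l \<le> L n" for n unfolding l_def using incL by (simp add: incseq_def)
  have lM: "l \<le> M n" for n using lL L_le_M order_trans by blast
  define a where "a = c / (p + 1)"
  define b where "b = c / (q + 1)"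
  \<comment> \<open>Half of the subcritical gap. The Green operator reaches every nonnegative
    exponent strictly above \<open>c - a - m = b - 2 * d\<close>; using only half of the gap keeps
    the inequality strict.\<close>
  define d where "d = (a + b - c + real m) / 2"
  have d2: "2 * d = a + b - c + real m" by (simp add: d_def)
  have d: "d > 0" using sub by (simp add: d_def a_def b_def)
  have a0: "a > 0" and b0: "b > 0" using p q c by (auto simp: a_def b_def)
  have pa: "p * a = c - a" and qb: "q * b = c - b" using p q by (auto simp: a_def b_def field_simps)
  \<comment> \<open>Truncated at 0 because the weighted bounds need nonnegative exponents: a tail
    integral does not decay as \<open>t\<close> tends to 0.\<close>
  define A where "A k = max 0 (a - real k * d)" for k
  define B where "B k = max 0 (b - real k * d)" for k
  \<comment> \<open>The first inequality is integrability at 0, the second an admissible gain. Since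
    \<open>p \<ge> 1\<close>, taking the power does not shrink the improvement \<open>k * d\<close>
    already achieved.\<close>
  have stepA: "p * A k < c \<and> p * A k - real m < B (Suc k)" for k
  proof (cases "A k = 0")
    case True
    then show ?thesis using c m by (simp add: B_def)
  next
    case False
    then have A: "A k = a - real k * d" by (auto simp: A_def max_def split: if_splits)
    have "p * A k = c - a - p * (real k * d)" unfolding A right_diff_distrib pa by simp
    moreover have "1 * (real k * d) \<le> p * (real k * d)" using p d by (intro mult_right_mono) auto
    ultimately have "p * A k \<le> c - a - real k * d" by simp
    moreover have "real k * d \<ge> 0" using d by simp
    moreover have "c - a - real m = b - 2 * d" using d2 by simp
    moreover have "B (Suc k) \<ge> b - (real k * d + d)" by (simp add: B_def algebra_simps)
    ultimately show ?thesis using a0 d by linarith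
  qed
  have stepB: "q * B k < c \<and> q * B k - real m < A (Suc k)" for k
  proof (cases "B k = 0")
    case True
    then show ?thesis using c m by (simp add: A_def)
  next
    case False
    then have B: "B k = b - real k * d" by (auto simp: B_def max_def split: if_splits)
    have "q * B k = c - b - q * (real k * d)" unfolding B right_diff_distrib qb by simp
    moreover have "1 * (real k * d) \<le> q * (real k * d)" using q d by (intro mult_right_mono) auto
    ultimately have "q * B k \<le> c - b - real k * d" by simp
    moreover have "real k * d \<ge> 0" using d by simp
    moreover have "c - b - real m = a - 2 * d" using d2 by simp
    moreover have "A (Suc k) \<ge> a - (real k * d + d)" by (simp add: A_def algebra_simps)
    ultimately show ?thesis using b0 d by linarith
  qed
  have AB0: "A k \<ge> 0" "B k \<ge> 0" for k by (auto simp: A_def B_def)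
  \<comment> \<open>Each improvement uses the bound on an earlier iterate, so the
    \<open>k\<close>-th one is claimed only from index \<open>k\<close> on, with a constant
    independent of \<open>n\<close>.\<close>
  have boot: "\<exists>C\<ge>0. \<forall>n\<ge>k. \<forall>t\<in>{0<..1}. W n t \<le> C * t powr (- A k) \<and> Z n t \<le> C * t powr (- B k)" for k
  proof (induction k)
    case 0
    let ?C = "max (c powr (1 / (p + 1))) (c powr (1 / (q + 1)))"
    have "W n t \<le> ?C * t powr (- A 0) \<and> Z n t \<le> ?C * t powr (- B 0)" if t: "t \<in> {0<..1}" for n t
    proof
      have "W n t \<le> c powr (1 / (p + 1)) * t powr (- A 0)"
        using profile_bound[OF W c p0 t] a0 by (simp add: A_def a_def)
      also have "\<dots> \<le> ?C * t powr (- A 0)" by (intro mult_right_mono) auto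
      finally show "W n t \<le> ?C * t powr (- A 0)" .
      have "Z n t \<le> c powr (1 / (q + 1)) * t powr (- B 0)"
        using profile_bound[OF Z c q0 t] b0 by (simp add: B_def b_def)
      also have "\<dots> \<le> ?C * t powr (- B 0)" by (intro mult_right_mono) auto
      finally show "Z n t \<le> ?C * t powr (- B 0)" .
    qed
    then show ?case by (intro exI[of _ ?C]) (auto simp: le_max_iff_disj)
  next
    case (Suc k)
    then obtain C where C: "C \<ge> 0" "\<And>n t. n \<ge> k \<Longrightarrow> t \<in> {0<..1} \<Longrightarrow> W n t \<le> C * t powr (- A k)"
      "\<And>n t. n \<ge> k \<Longrightarrow> t \<in> {0<..1} \<Longrightarrow> Z n t \<le> C * t powr (- B k)" by blast
    obtain K1 where K1: "K1 > 0" "\<forall>w l C. profile c p w \<longrightarrow> 0 < l \<longrightarrow> l \<le> level m c p q w \<longrightarrow> 0 \<le> C \<longrightarrow>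
      (\<forall>t\<in>{0<..1}. w t \<le> C * t powr (- A k)) \<longrightarrow>
      (\<forall>t\<in>{0<..1}. half_step m c p q w t \<le> K1 * C powr p / l * t powr (- B (Suc k)))"
      using half_step_bound[OF AB0(1) _ AB0(2) _ p0 q0, of k "Suc k"] stepA[of k] by blast
    obtain K2 where K2: "K2 > 0" "\<forall>w l C. profile c q w \<longrightarrow> 0 < l \<longrightarrow> l \<le> level m c q p w \<longrightarrow> 0 \<le> C \<longrightarrow>
      (\<forall>t\<in>{0<..1}. w t \<le> C * t powr (- B k)) \<longrightarrow>
      (\<forall>t\<in>{0<..1}. half_step m c q p w t \<le> K2 * C powr q / l * t powr (- A (Suc k)))"
      using half_step_bound[OF AB0(2) _ AB0(1) _ q0 p0, of k "Suc k"] stepB[of k] by blast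
    let ?C = "max (K1 * C powr p / l) (K2 * C powr q / l)"
    have "W n t \<le> ?C * t powr (- A (Suc k)) \<and> Z n t \<le> ?C * t powr (- B (Suc k))"
      if n: "n \<ge> Suc k" and t: "t \<in> {0<..1}" for n t
    proof
      obtain n' where n': "n = Suc n'" "n' \<ge> k" using n by (cases n) auto
      have "W n t \<le> K2 * C powr q / l * t powr (- A (Suc k))"
        unfolding n'(1) W_Suc
        using K2(2)[rule_format, OF Z l lM[unfolded M_def] C(1) C(3)[OF n'(2)] t] by blast
      also have "\<dots> \<le> ?C * t powr (- A (Suc k))" by (intro mult_right_mono) auto
      finally show "W n t \<le> ?C * t powr (- A (Suc k))" .
      have "k \<le> n" using n by simp
      have "Z n t \<le> K1 * C powr p / l * t powr (- B (Suc k))"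
        unfolding Z_def
        using K1(2)[rule_format, OF W l lL[unfolded L_def] C(1) C(2)[OF \<open>k \<le> n\<close>] t] by blast
      also have "\<dots> \<le> ?C * t powr (- B (Suc k))" by (intro mult_right_mono) auto
      finally show "Z n t \<le> ?C * t powr (- B (Suc k))" .
    qed
    moreover have "?C \<ge> 0" using K1 l by (auto simp: le_max_iff_disj)
    ultimately show ?case by blast
  qed
  \<comment> \<open>After finitely many rounds both exponents reach 0, and the power bounds become
    sup bounds.\<close>
  obtain k where k: "max a b / d < real k" using reals_Archimedean2 by blast
  then have "a - real k * d \<le> 0" "b - real k * d \<le> 0" using d by (auto simp: field_simps)
  then have AB: "A k = 0" "B k = 0" by (auto simp: A_def B_def)
  obtain C where "C \<ge> 0" and C: "\<And>n t. n \<ge> k \<Longrightarrow> t \<in> {0<..1} \<Longrightarrow> W n t \<le> C \<and> Z n t \<le> C"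
    using boot[of k] unfolding AB by fastforce
  have CW: "W n t \<le> C" if "n \<ge> k" "t \<in> {0..1}" for n t
    by (rule continuous_on_eq_unit[OF profileD(1)[OF W] continuous_on_const _ that(2)]) (use C that in blast)
  have CZ: "Z n t \<le> C" if "n \<ge> k" "t \<in> {0..1}" for n t
    by (rule continuous_on_eq_unit[OF profileD(1)[OF Z] continuous_on_const _ that(2)]) (use C that in blast)
  \<comment> \<open>The shift by one makes every \<open>F n\<close> a half step of a bounded profile
    \<open>Z (n + k)\<close>, hence Lipschitz with a constant independent of
    \<open>n\<close>.\<close>
  define F where "F n = W (Suc (n + k))" for n
  define D where "D = C powr q / l"
  have lip: "\<bar>F n s - F n t\<bar> \<le> D * \<bar>s - t\<bar>" if "s \<in> {0..1}" "t \<in> {0..1}" for n s t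
    unfolding F_def W_Suc D_def
    by (rule half_step_lipschitz[OF Z CZ q0 l _ that]) (use lM[unfolded M_def] in auto)
  have D0: "D \<ge> 0" using l by (simp add: D_def)
  obtain g r where g: "continuous_on {0..1} g" and r: "strict_mono (r :: nat \<Rightarrow> nat)"
    and conv: "\<And>e. 0 < e \<Longrightarrow> \<exists>N. \<forall>n x. n \<ge> N \<and> x \<in> {0..1} \<longrightarrow> norm (F (r n) x - g x) < e"
  proof (rule Arzela_Ascoli[of "{0..1::real}" F C])
    show "norm (F n x) \<le> C" if "x \<in> {0..1}" for n x
      using CW[of "Suc (n + k)" x] profileD(2)[OF W that, of "Suc (n + k)"] that by (simp add: F_def)
    show "\<exists>d. 0 < d \<and> (\<forall>n y. y \<in> {0..1} \<and> norm (x - y) < d \<longrightarrow> norm (F n x - F n y) < e)"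
      if x: "x \<in> {0..1}" and e: "0 < e" for x e
    proof (intro exI[of _ "e / (D + 1)"] conjI allI impI)
      fix n y assume y: "y \<in> {0..1} \<and> norm (x - y) < e / (D + 1)"
      have "\<bar>F n x - F n y\<bar> \<le> D * \<bar>x - y\<bar>" using lip x y by blast
      also have "\<dots> \<le> (D + 1) * \<bar>x - y\<bar>" by (intro mult_right_mono) auto
      also have "\<dots> < e" using y D0 by (simp add: field_simps)
      finally show "norm (F n x - F n y) < e" by simp
    qed (use e D0 in auto)
  qed auto
  define G where "G n = F (r n)" for n
  have Gp: "profile c p (G n)" for n unfolding G_def F_def by (rule W)
  have GC: "G n t \<le> C" if "t \<in> {0..1}" for n t unfolding G_def F_def using that by (intro CW) auto
  have HC: "half_step m c p q (G n) t \<le> C" if "t \<in> {0..1}" for n t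
    unfolding G_def F_def Z_def[symmetric] using that by (intro CZ) auto
  have Hp: "profile c q (half_step m c p q (G n))" for n unfolding G_def F_def Z_def[symmetric] by (rule Z)
  have lim: "uniform_limit {0..1} G g sequentially"
    unfolding uniform_limit_sequentially_iff G_def dist_norm using conv by blast
  have gp: "profile c p g" by (rule profile_uniform_limit[OF lim Gp GC p0 c])
  note lim1 = half_step_uniform_limit[OF lim Gp GC p0 q0]
  note lim2 = half_step_uniform_limit[OF lim1(2) Hp HC q0 p0]
  have "L n \<le> C powr p" for n
  proof -
    have "L n \<le> L (n + k)" using incL by (simp add: incseq_def)
    also have "\<dots> \<le> C powr p" unfolding L_def by (rule level_le_bound[OF W CW p0 q0]) auto
    finally show ?thesis .
  qed
  then obtain S where S: "L \<longlonglongrightarrow> S" using incseq_convergent[OF incL] by blast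
  have MS: "M \<longlonglongrightarrow> S"
    by (rule tendsto_sandwich[OF _ _ S LIMSEQ_Suc[OF S]]) (use L_le_M M_le_L in auto)
  \<comment> \<open>The same indices select from \<open>L\<close> and from \<open>M\<close>, so both
    levels at the limit profile equal \<open>S\<close>.\<close>
  have sm: "strict_mono (\<lambda>n. Suc (r n + k))" using r by (auto simp: strict_mono_def)
  have "(\<lambda>n. level m c p q (G n)) \<longlonglongrightarrow> S"
    using LIMSEQ_subseq_LIMSEQ[OF S sm] by (simp add: o_def L_def G_def F_def)
  then have e1: "level m c p q g = S" using lim1(1) LIMSEQ_unique by blast
  have "(\<lambda>n. level m c q p (half_step m c p q (G n))) \<longlonglongrightarrow> S"
    using LIMSEQ_subseq_LIMSEQ[OF MS sm] by (simp add: o_def M_def G_def F_def Z_def)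
  then have e2: "level m c q p (half_step m c p q g) = S" using lim2(1) LIMSEQ_unique by blast
  let ?z = "half_step m c p q g"
  have zp: "profile c q ?z" by (rule half_step_profile[OF m c gp p0 q0])
  have fixpt: "half_step m c q p ?z t = g t" if "t \<in> {0..1}" for t
    by (rule level_le(2)[OF m c gp p0 q0 _ that]) (simp add: e1 e2)
  have "S > 0" using level_pos[OF m c gp p0 q0] e1 by simp
  moreover have "green m c (\<lambda>s. g s powr p) t = S * ?z t" for t
    using green_eq_half_step[OF m c gp p0 q0, of t] e1 by simp
  moreover have "green m c (\<lambda>s. ?z s powr q) t = S * g t" if "t \<in> {0..1}" for t
    using green_eq_half_step[OF m c zp q0 p0, of t] e2 fixpt[OF that] by simp
  ultimately show ?thesis using gp zp by blast
qed

lemma radial_solution: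
  assumes p: "p \<ge> 1" and q: "q \<ge> 1" and pq: "\<not> (p = 1 \<and> q = 1)"
    and sub: "c / (p + 1) + c / (q + 1) > c - real m"
  shows "\<exists>u v. continuous_on {0..1} u \<and> continuous_on {0..1} v \<and>
    (\<forall>t\<in>{0..1}. 0 \<le> u t \<and> 0 \<le> v t) \<and> (\<forall>t\<in>{0..<1}. 0 < u t \<and> 0 < v t) \<and>
    (\<forall>t\<in>{0..1}. green m c (\<lambda>s. u s powr p) t = v t \<and> green m c (\<lambda>s. v s powr q) t = u t)"
proof -
  have p0: "p > 0" and q0: "q > 0" using p q by auto
  have "p * q > 1"
  proof (cases "p = 1")
    case False
    then have "1 * 1 < p * q" using p q by (intro mult_less_le_imp_less) auto
    then show ?thesis by simp
  qed (use pq q in auto)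
  then have ne: "1 - p * q \<noteq> 0" by simp
  obtain w z l where l: "l > 0" and w: "profile c p w" and z: "profile c q z"
    and eq: "\<And>t. t \<in> {0..1} \<Longrightarrow> green m c (\<lambda>s. w s powr p) t = l * z t"
      "\<And>t. t \<in> {0..1} \<Longrightarrow> green m c (\<lambda>s. z s powr q) t = l * w t"
    using fixed_profiles[OF p q sub] by blast
  \<comment> \<open>The factors must satisfy \<open>a powr p * l = b\<close> and
    \<open>b powr q * l = a\<close>; eliminating \<open>b\<close> gives
    \<open>a powr (1 - p * q) = l powr (q + 1)\<close>, which is solvable as \<open>p * q\<close> is
    not 1.\<close>
  define a where "a = l powr ((q + 1) / (1 - p * q))"
  define b where "b = l powr ((p + 1) / (1 - p * q))"
  have a0: "a > 0" and b0: "b > 0" using l by (auto simp: a_def b_def)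
  have ab: "a powr p * l = b"
  proof -
    have "a powr p * l = l powr ((q + 1) / (1 - p * q) * p + 1)" using l by (simp add: a_def powr_powr powr_add)
    also have "(q + 1) / (1 - p * q) * p + 1 = (p + 1) / (1 - p * q)" using ne by (simp add: field_simps)
    finally show ?thesis by (simp add: b_def)
  qed
  have ba: "b powr q * l = a"
  proof -
    have "b powr q * l = l powr ((p + 1) / (1 - p * q) * q + 1)" using l by (simp add: b_def powr_powr powr_add)
    also have "(p + 1) / (1 - p * q) * q + 1 = (q + 1) / (1 - p * q)" using ne by (simp add: field_simps)
    finally show ?thesis by (simp add: a_def)
  qed
  have gv: "green m c (\<lambda>s. (a * w s) powr p) t = b * z t" if t: "t \<in> {0..1}" for t
  proof -
    have "green m c (\<lambda>s. (a * w s) powr p) t = green m c (\<lambda>s. a powr p * w s powr p) t"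
      by (rule green_cong[OF _ t]) (use profileD(2)[OF w] a0 in \<open>simp add: powr_mult\<close>)
    then show ?thesis using eq(1)[OF t] ab by (simp add: green_cmult flip: mult.assoc)
  qed
  have gu: "green m c (\<lambda>s. (b * z s) powr q) t = a * w t" if t: "t \<in> {0..1}" for t
  proof -
    have "green m c (\<lambda>s. (b * z s) powr q) t = green m c (\<lambda>s. b powr q * z s powr q) t"
      by (rule green_cong[OF _ t]) (use profileD(2)[OF z] b0 in \<open>simp add: powr_mult\<close>)
    then show ?thesis using eq(2)[OF t] ba by (simp add: green_cmult flip: mult.assoc)
  qed
  have wpos: "w t > 0" if "t \<in> {0..<1}" for t
    using green_profile_pos[OF m c z q0 that] eq(2)[of t] l that by (simp add: zero_less_mult_iff)
  have zpos: "z t > 0" if "t \<in> {0..<1}" for t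
    using green_profile_pos[OF m c w p0 that] eq(1)[of t] l that by (simp add: zero_less_mult_iff)
  show ?thesis
    by (rule exI[of _ "\<lambda>t. a * w t"], rule exI[of _ "\<lambda>t. b * z t"])
       (use gu gv wpos zpos a0 b0 profileD(1,2)[OF w] profileD(1,2)[OF z] in
         \<open>auto intro!: continuous_intros\<close>)
qed

end

section \<open>Regularity and the polyharmonic equation\<close>

text \<open>Derivatives are taken within \<open>S\<close>, hence one-sided at endpoints that belong
  to \<open>S\<close>. The cases of interest are \<open>{0..<1}\<close>, \<open>{0<..1}\<close> and
  \<open>{0..1}\<close>.\<close>

primrec Ck :: "nat \<Rightarrow> real set \<Rightarrow> (real \<Rightarrow> real) \<Rightarrow> bool" where
  "Ck 0 S f \<longleftrightarrow> continuous_on S f"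
| "Ck (Suc k) S f \<longleftrightarrow> (\<exists>g. Ck k S g \<and> (\<forall>t\<in>S. (f has_real_derivative g t) (at t within S)))"

lemma has_derivative_imp_continuous_on:
  "(\<And>t. t \<in> S \<Longrightarrow> (f has_real_derivative g t) (at t within S)) \<Longrightarrow> continuous_on S f"
  using DERIV_continuous by (fastforce simp: continuous_on_eq_continuous_within)

lemma Ck_continuous: "Ck k S f \<Longrightarrow> continuous_on S f"
  by (cases k) (auto intro: has_derivative_imp_continuous_on)

lemma Ck_Suc_D: "Ck (Suc k) S f \<Longrightarrow> Ck k S f"
proof (induction k arbitrary: f)
  case 0
  show ?case using Ck_continuous[OF 0] by simp
next
  case (Suc k)
  then obtain g where "Ck (Suc k) S g" "\<forall>t\<in>S. (f has_real_derivative g t) (at t within S)" by auto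
  with Suc.IH[of g] show ?case by (auto intro!: exI[of _ g])
qed

lemma Ck_le:
  assumes "Ck k S f" "j \<le> k"
  shows "Ck j S f"
  using assms(2,1) by (induction rule: dec_induct) (auto dest: Ck_Suc_D simp del: Ck.simps)

lemma Ck_cong:
  assumes "Ck k S f" "\<And>t. t \<in> S \<Longrightarrow> f t = g t"
  shows "Ck k S g"
proof (cases k)
  case 0
  then show ?thesis using assms continuous_on_cong[of S S f g] by simp
next
  case (Suc j)
  then obtain h where h: "Ck j S h" "\<And>t. t \<in> S \<Longrightarrow> (f has_real_derivative h t) (at t within S)"
    using assms by auto
  have "(g has_real_derivative h t) (at t within S)" if "t \<in> S" for t
    by (rule has_field_derivative_transform_within[OF h(2)[OF that], of 1]) (use that assms in auto)
  then show ?thesis using Suc h(1) by auto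
qed

lemma Ck_subset: "Ck k S f \<Longrightarrow> T \<subseteq> S \<Longrightarrow> Ck k T f"
proof (induction k arbitrary: f)
  case (Suc k)
  then obtain g where "Ck k S g" "\<forall>t\<in>S. (f has_real_derivative g t) (at t within S)" by auto
  with Suc show ?case by (auto intro!: exI[of _ g] intro: has_field_derivative_subset)
qed (auto intro: continuous_on_subset)

lemma Ck_const: "Ck k S (\<lambda>_. a)"
proof (induction k arbitrary: a)
  case (Suc k)
  then show ?case by (auto intro!: exI[of _ "\<lambda>_. 0"])
qed simp

lemma Ck_ident: "Ck k S (\<lambda>t. t)"
  by (cases k) (auto intro!: exI[of _ "\<lambda>_. 1"] Ck_const continuous_intros)

lemma Ck_add: "Ck k S f \<Longrightarrow> Ck k S g \<Longrightarrow> Ck k S (\<lambda>t. f t + g t)"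
proof (induction k arbitrary: f g)
  case (Suc k)
  then obtain f' g' where "Ck k S f'" "\<forall>t\<in>S. (f has_real_derivative f' t) (at t within S)"
    "Ck k S g'" "\<forall>t\<in>S. (g has_real_derivative g' t) (at t within S)" by auto
  with Suc.IH show ?case by (auto intro!: exI[of _ "\<lambda>t. f' t + g' t"] DERIV_add)
qed (auto intro: continuous_intros)

lemma Ck_mult: "Ck k S f \<Longrightarrow> Ck k S g \<Longrightarrow> Ck k S (\<lambda>t. f t * g t)"
proof (induction k arbitrary: f g)
  case (Suc k)
  then obtain f' g' where 1: "Ck k S f'" "\<forall>t\<in>S. (f has_real_derivative f' t) (at t within S)"
    "Ck k S g'" "\<forall>t\<in>S. (g has_real_derivative g' t) (at t within S)" by auto
  moreover have "Ck k S f" "Ck k S g" using Suc.prems Ck_Suc_D by blast+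
  ultimately show ?case
    using Suc.IH by (auto intro!: exI[of _ "\<lambda>t. f' t * g t + g' t * f t"] DERIV_mult Ck_add)
qed (auto intro: continuous_intros)

lemma Ck_cmult: "Ck k S f \<Longrightarrow> Ck k S (\<lambda>t. a * f t)"
  by (rule Ck_mult[OF Ck_const])

lemma Ck_powr: "Ck k S f \<Longrightarrow> (\<And>t. t \<in> S \<Longrightarrow> f t > 0) \<Longrightarrow> Ck k S (\<lambda>t. f t powr r)"
proof (induction k arbitrary: r)
  case 0
  have "\<forall>t\<in>S. f t \<noteq> 0" using 0(2) by fastforce
  with 0 show ?case by (auto intro!: continuous_intros)
next
  case (Suc k)
  from Suc.prems obtain f' where f': "Ck k S f'" "\<forall>t\<in>S. (f has_real_derivative f' t) (at t within S)" by auto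
  have "Ck k S (\<lambda>t. r * f t powr (r - 1))"
    using Suc.IH[OF Ck_Suc_D[OF Suc.prems(1)] Suc.prems(2)] by (rule Ck_cmult)
  then have "Ck k S (\<lambda>t. r * f t powr (r - 1) * f' t)" by (rule Ck_mult[OF _ f'(1)])
  moreover have "((\<lambda>t. f t powr r) has_real_derivative r * f t powr (r - 1) * f' t) (at t within S)"
    if "t \<in> S" for t
    using f'(2) Suc.prems(2) that
    by (auto intro!: DERIV_chain2[where f = "\<lambda>x. x powr r" and g = f] has_real_derivative_powr)
  ultimately show ?case by auto
qed

lemma Ck_tail_int:
  assumes "Ck k {0..1} f"
  shows "Ck (Suc k) {0..1} (tail_int f)"
  using tail_int_has_derivative[OF Ck_continuous[OF assms]] Ck_cmult[OF assms, of "- 1"] by auto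

lemma Ck_tail_ints: "Ck k {0..1} f \<Longrightarrow> Ck (j + k) {0..1} ((tail_int ^^ j) f)"
  by (induction j) (auto intro!: Ck_tail_int simp del: Ck.simps)

lemma Ck_euler_inv:
  assumes "Ck k S f" "convex S" "\<And>t s. t \<in> S \<Longrightarrow> s \<in> {0..1} \<Longrightarrow> t * s \<in> S" "c > 1"
  shows "Ck k S (euler_inv c f)"
  using assms(1,4)
proof (induction k arbitrary: f c)
  case 0
  then show ?case using euler_inv_continuous assms(3) by auto
next
  case (Suc k)
  then obtain g where g: "Ck k S g" "\<And>t. t \<in> S \<Longrightarrow> (f has_real_derivative g t) (at t within S)" by auto
  have "Ck k S (euler_inv (c + 1) g)" using Suc.IH[OF g(1)] Suc.prems by simp
  moreover have "(euler_inv c f has_real_derivative euler_inv (c + 1) g t) (at t within S)" if "t \<in> S" for t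
    by (rule euler_inv_has_derivative[OF g(2) Ck_continuous[OF g(1)] assms(2,3) Suc.prems(2) that])
  ultimately show ?case by auto
qed

text \<open>The derivative is expressed through \<open>f\<close>, \<open>t powr (- 1)\<close> and
  the function itself, so each known order of smoothness yields the next, up to one more than
  \<open>f\<close> has. On \<open>{0..<1}\<close> only the smoothness of \<open>f\<close> is
  preserved.\<close>

lemma Ck_euler_inv_pos:
  assumes f: "continuous_on {0..1} f" and k: "Ck k {0<..1} f" and c: "c > 1"
  shows "Ck (Suc k) {0<..1} (euler_inv c f)"
proof -
  have "Ck j {0<..1} (euler_inv c f)" if "j \<le> Suc k" for j
    using that
  proof (induction j)
    case 0
    have "continuous_on {0..1} (euler_inv c f)"
      by (rule euler_inv_continuous[OF f mult_unit_interval c])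
    then show ?case by (auto intro: continuous_on_subset)
  next
    case (Suc j)
    have 1: "Ck j {0<..1} (\<lambda>t. t powr (- 1))" by (rule Ck_powr[OF Ck_ident]) auto
    have "Ck j {0<..1} (\<lambda>t. (f t + (- c) * euler_inv c f t) * t powr (- 1))"
      using Suc by (intro Ck_mult[OF Ck_add[OF Ck_le[OF k] Ck_cmult] 1]) auto
    moreover have "(euler_inv c f has_real_derivative (f t + (- c) * euler_inv c f t) * t powr (- 1))
        (at t within {0<..1})" if "t \<in> {0<..1}" for t
      using euler_inv_has_derivative_pos[OF f c that] that by (simp add: powr_minus_divide)
    ultimately show ?case by (auto simp del: powr_minus)
  qed
  then show ?thesis by blast
qed

lemma at_within_unit_left: "t < 1 \<Longrightarrow> at t within {0..<1} = at t within {0..1::real}"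
  by (rule at_within_nhd[of _ "{..<1}"]) auto

lemma at_within_unit_right: "0 < t \<Longrightarrow> at t within {0<..1} = at t within {0..1::real}"
  by (rule at_within_nhd[of _ "{0<..}"]) auto

lemma Ck_glue:
  assumes "Ck k {0..<1} f" "Ck k {0<..1} f"
  shows "Ck k {0..1} f"
  using assms
proof (induction k arbitrary: f)
  case 0
  show ?case unfolding Ck.simps continuous_on_eq_continuous_within
  proof
    fix t :: real assume t: "t \<in> {0..1}"
    show "continuous (at t within {0..1}) f"
    proof (cases "t < 1")
      case True
      then show ?thesis
        using 0(1) t by (auto simp: continuous_on_eq_continuous_within simp flip: at_within_unit_left)
    next
      case False
      then have "continuous (at t within {0<..1}) f"
        using 0(2) t by (simp add: continuous_on_eq_continuous_within)
      then show ?thesis using at_within_unit_right[of t] False by simp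
    qed
  qed
next
  case (Suc k)
  from Suc.prems obtain g1 g2 where g1: "Ck k {0..<1} g1"
      "\<And>t. t \<in> {0..<1} \<Longrightarrow> (f has_real_derivative g1 t) (at t within {0..<1})"
    and g2: "Ck k {0<..1} g2" "\<And>t. t \<in> {0<..1} \<Longrightarrow> (f has_real_derivative g2 t) (at t within {0<..1})"
    by auto
  \<comment> \<open>Any cut inside the open interval would do, since the two derivatives agree on
    the overlap.\<close>
  define g where "g t = (if t < 1 / 2 then g1 t else g2 t)" for t
  have eq: "g1 t = g2 t" if t: "0 < t" "t < 1" for t
  proof -
    have "(f has_real_derivative g1 t) (at t)" "(f has_real_derivative g2 t) (at t)"
      using g1(2)[of t] g2(2)[of t] t at_within_interior[of t "{0..<1}"] at_within_interior[of t "{0<..1}"]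
      by auto
    then show ?thesis by (rule DERIV_unique)
  qed
  have gl: "g1 t = g t" if "t \<in> {0..<1}" for t using that eq by (auto simp: g_def)
  have gr: "g2 t = g t" if "t \<in> {0<..1}" for t using that eq by (auto simp: g_def)
  have "Ck k {0..1} g" by (intro Suc.IH Ck_cong[OF g1(1) gl] Ck_cong[OF g2(1) gr])
  moreover have "(f has_real_derivative g t) (at t within {0..1})" if t: "t \<in> {0..1}" for t
  proof (cases "t < 1")
    case True
    then show ?thesis using g1(2)[of t] gl[of t] t at_within_unit_left[of t] by auto
  next
    case False
    then show ?thesis using g2(2)[of t] gr[of t] t at_within_unit_right[of t] by auto
  qed
  ultimately show ?case by auto
qed

lemma unit_left_star: "t \<in> {0..<1} \<Longrightarrow> s \<in> {0..1} \<Longrightarrow> t * s \<in> {0..<1::real}"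
  by (auto intro: le_less_trans[OF mult_left_le])

lemma Ck_euler_stack_left:
  assumes "Ck k {0..<1} f" "c > 1"
  shows "Ck k {0..<1} (euler_stack j c f)"
proof (induction j)
  case (Suc j)
  show ?case unfolding euler_stack.simps
    by (rule Ck_euler_inv[OF Suc _ unit_left_star]) (use assms in auto)
qed (use assms in simp)

text \<open>Every operator in the stack gains a derivative away from 0, starting from mere
  continuity. This compensates for the missing smoothness of the data at
  \<open>t = 1\<close>.\<close>

lemma Ck_euler_stack_right:
  assumes "continuous_on {0..1} f" "c > 1"
  shows "Ck j {0<..1} (euler_stack j c f)"
proof (induction j)
  case 0
  show ?case using assms by (auto intro: continuous_on_subset)
next
  case (Suc j)
  show ?case unfolding euler_stack.simps
    by (rule Ck_euler_inv_pos[OF euler_stack_continuous_unit Suc]) (use assms in auto)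
qed

text \<open>With the constant moved to the datum, \<open>green\<close> is literally an iterated tail
  integral, as the differentiation and vanishing lemmas need it.\<close>

lemma green_alt:
  "green m c f = (tail_int ^^ m) (euler_stack m c (\<lambda>s. (1 / 4 ^ m) * f s))"
  by (simp only: euler_stack_cmult tail_ints_cmult) (simp add: green_def[abs_def])

text \<open>First pass of the regularity argument: the integrations alone give \<open>m\<close>
  derivatives. Where the profile is positive its powers inherit them, and this is the hypothesis of
  \<open>Ck_green\<close>.\<close>

lemma Ck_green_continuous:
  assumes "continuous_on {0..1} f" "c > 1"
  shows "Ck m {0..1} (green m c f)"
proof -
  have "Ck (m + 0) {0..1} (green m c f)"
    unfolding green_alt
    by (rule Ck_tail_ints)
       (use assms in \<open>auto intro!: euler_stack_continuous_unit continuous_intros\<close>)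
  then show ?thesis by simp
qed

text \<open>Smoothness of the stack comes from \<open>f\<close> on the left and from the gain of the
  inverse Euler operators on the right; the \<open>m\<close> integrations then double the
  order.\<close>

lemma Ck_green:
  assumes "continuous_on {0..1} f" "c > 1" "Ck m {0..<1} f"
  shows "Ck (2 * m) {0..1} (green m c f)"
proof -
  have "Ck m {0..1} (euler_stack m c (\<lambda>s. (1 / 4 ^ m) * f s))"
    by (intro Ck_glue Ck_euler_stack_left Ck_euler_stack_right Ck_cmult continuous_intros assms)
  then show ?thesis unfolding green_alt mult_2 by (rule Ck_tail_ints)
qed

section \<open>Differential operators in \<open>t\<close> that undo the Green operator\<close>

text \<open>The sign makes it the left inverse of \<open>tail_int\<close>. The derivative is
  one-sided at 0, and \<open>t = 1\<close> is left out because the equation is needed only in the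
  open ball.\<close>

definition ndiff :: "(real \<Rightarrow> real) \<Rightarrow> real \<Rightarrow> real" where
  "ndiff f t = - vector_derivative f (at t within {0..<1})"

definition euler_op :: "real \<Rightarrow> (real \<Rightarrow> real) \<Rightarrow> real \<Rightarrow> real" where
  "euler_op c f t = c * f t - t * ndiff f t"

lemma vector_derivative_within_cong:
  assumes "\<And>s. s \<in> T \<Longrightarrow> f s = g s" "t \<in> T"
  shows "vector_derivative f (at t within T) = vector_derivative g (at t within T)"
proof -
  have "(f has_vector_derivative y) (at t within T) \<longleftrightarrow> (g has_vector_derivative y) (at t within T)" for y
    using has_vector_derivative_transform[of t T f g y] has_vector_derivative_transform[of t T g f y] assms
    by metis
  then show ?thesis by (simp add: vector_derivative_def)
qed

lemma at_within_interval_nontrivial: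
  fixes S :: "real set"
  assumes "connected S" "t \<in> S" "\<And>x. S \<noteq> {x}"
  shows "at t within S \<noteq> bot"
  using connected_imp_perfect[OF assms(1,2,3)] by (simp add: trivial_limit_within)

lemma at_within_unit_nontrivial: "t \<in> {0..<1} \<Longrightarrow> at t within {0..<1::real} \<noteq> bot"
proof (rule at_within_interval_nontrivial)
  have "0 \<in> {0..<1::real}" "1/2 \<in> {0..<1::real}" by auto
  then show "{0..<1::real} \<noteq> {x}" for x by (metis singletonD zero_neq_numeral divide_eq_0_iff zero_neq_one)
qed auto

lemma ndiff_eq:
  assumes "(f has_real_derivative y) (at t within {0..<1})" "t \<in> {0..<1}"
  shows "ndiff f t = - y"
  unfolding ndiff_def
  using vector_derivative_within[OF at_within_unit_nontrivial[OF assms(2)]] assms(1)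
  by (simp add: has_real_derivative_iff_has_vector_derivative)

lemma ndiff_cong: "(\<And>s. s \<in> {0..<1} \<Longrightarrow> f s = g s) \<Longrightarrow> t \<in> {0..<1} \<Longrightarrow> ndiff f t = ndiff g t"
  unfolding ndiff_def by (metis vector_derivative_within_cong)

lemma Ck_ndiff:
  assumes "Ck (Suc k) {0..<1} f"
  shows "Ck k {0..<1} (ndiff f)"
    and "t \<in> {0..<1} \<Longrightarrow> (f has_real_derivative - ndiff f t) (at t within {0..<1})"
proof -
  obtain g where g: "Ck k {0..<1} g" "\<And>t. t \<in> {0..<1} \<Longrightarrow> (f has_real_derivative g t) (at t within {0..<1})"
    using assms by auto
  have eq: "ndiff f t = - g t" if "t \<in> {0..<1}" for t using ndiff_eq[OF g(2)] that by simp
  show "Ck k {0..<1} (ndiff f)"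
    by (rule Ck_cong[OF Ck_cmult[OF g(1), of "- 1"]]) (use eq in auto)
  show "(f has_real_derivative - ndiff f t) (at t within {0..<1})" if "t \<in> {0..<1}"
    using g(2)[OF that] eq[OF that] by simp
qed

lemma Ck_euler_op:
  assumes "Ck (Suc k) {0..<1} f"
  shows "Ck k {0..<1} (euler_op c f)"
proof -
  have "Ck k {0..<1} (\<lambda>t. c * f t + t * ((- 1) * ndiff f t))"
    by (intro Ck_add Ck_cmult Ck_mult Ck_ident Ck_Suc_D[OF assms] Ck_ndiff(1)[OF assms])
  then show ?thesis by (rule Ck_cong) (simp add: euler_op_def)
qed

lemma Ck_ndiffs: "Ck (j + k) {0..<1} f \<Longrightarrow> Ck k {0..<1} ((ndiff ^^ j) f)"
proof (induction j arbitrary: k)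
  case (Suc j)
  have "Ck (Suc k) {0..<1} ((ndiff ^^ j) f)" by (rule Suc.IH) (use Suc.prems in simp)
  then show ?case using Ck_ndiff(1) by simp
qed simp

lemma euler_op_cong:
  "(\<And>s. s \<in> {0..<1} \<Longrightarrow> f s = g s) \<Longrightarrow> t \<in> {0..<1} \<Longrightarrow> euler_op c f t = euler_op c g t"
  unfolding euler_op_def using ndiff_cong[of f g t] by simp

text \<open>A derivative passes the operator \<open>t * d/dt + c\<close> at the cost of raising
  \<open>c\<close> by one; iterating this produces the shifted parameters.\<close>

lemma ndiff_euler_op:
  assumes "Ck 2 {0..<1} f" "t \<in> {0..<1}"
  shows "ndiff (euler_op c f) t = euler_op (c + 1) (ndiff f) t"
proof -
  have f2: "Ck (Suc (Suc 0)) {0..<1} f" using assms(1) by (simp only: numeral_2_eq_2)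
  have f1: "Ck (Suc 0) {0..<1} (ndiff f)" by (rule Ck_ndiff(1)[OF f2])
  have "((\<lambda>t. c * f t - t * ndiff f t) has_real_derivative
      c * (- ndiff f t) - (1 * ndiff f t + (- ndiff (ndiff f) t) * t)) (at t within {0..<1})"
    by (intro DERIV_diff DERIV_cmult DERIV_mult DERIV_ident Ck_ndiff(2)[OF f2] Ck_ndiff(2)[OF f1] assms(2))
  then show ?thesis
    unfolding euler_op_def[abs_def] by (subst ndiff_eq[OF _ assms(2)]) (auto simp: algebra_simps)
qed

lemma ndiffs_euler_op:
  assumes "Ck (Suc k) {0..<1} f" "t \<in> {0..<1}"
  shows "(ndiff ^^ k) (euler_op c f) t = euler_op (c + real k) ((ndiff ^^ k) f) t"
  using assms
proof (induction k arbitrary: t)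
  case (Suc k)
  have "(ndiff ^^ Suc k) (euler_op c f) t = ndiff (euler_op (c + real k) ((ndiff ^^ k) f)) t"
    using Suc.IH[OF Ck_Suc_D[OF Suc.prems(1)]] Suc.prems(2) by (auto intro!: ndiff_cong)
  also have "\<dots> = euler_op (c + real k + 1) (ndiff ((ndiff ^^ k) f)) t"
    by (rule ndiff_euler_op[OF Ck_ndiffs Suc.prems(2)]) (use Suc.prems(1) in simp)
  finally show ?case by (simp add: add_ac)
qed simp

text \<open>The operator with the largest shift acts first, so it meets and cancels the outermost
  inverse in \<open>euler_stack\<close>.\<close>

primrec euler_ops :: "nat \<Rightarrow> real \<Rightarrow> (real \<Rightarrow> real) \<Rightarrow> real \<Rightarrow> real" where
  "euler_ops 0 c f = f"
| "euler_ops (Suc k) c f = euler_ops k c (euler_op (c + real k) f)"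

lemma euler_ops_cong:
  "(\<And>s. s \<in> {0..<1} \<Longrightarrow> f s = g s) \<Longrightarrow> t \<in> {0..<1} \<Longrightarrow> euler_ops k c f t = euler_ops k c g t"
proof (induction k arbitrary: f g t)
  case (Suc k)
  show ?case unfolding euler_ops.simps
    by (rule Suc.IH[OF euler_op_cong Suc.prems(2)]) (use Suc.prems(1) in auto)
qed simp

text \<open>In the variable \<open>t = |x|^2\<close> the operator \<open>- \<Delta> / 4\<close> is
  \<open>euler_op (N / 2) \<circ> ndiff\<close>; moving the derivatives to the right turns its powers into
  a product of Euler operators after an iterated derivative.\<close>

definition radial_laplace :: "real \<Rightarrow> (real \<Rightarrow> real) \<Rightarrow> real \<Rightarrow> real" where
  "radial_laplace c f = euler_op c (ndiff f)"

lemma Ck_radial_laplace: "Ck (Suc (Suc k)) {0..<1} f \<Longrightarrow> Ck k {0..<1} (radial_laplace c f)"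
  unfolding radial_laplace_def by (rule Ck_euler_op[OF Ck_ndiff(1)])

lemma Ck_radial_laplaces:
  "Ck (2 * j + k) {0..<1} f \<Longrightarrow> Ck k {0..<1} ((radial_laplace c ^^ j) f)"
proof (induction j arbitrary: k)
  case (Suc j)
  have "Ck (Suc (Suc k)) {0..<1} ((radial_laplace c ^^ j) f)" by (rule Suc.IH) (use Suc.prems in simp)
  then show ?case using Ck_radial_laplace by simp
qed simp

lemma radial_laplaces_eq:
  assumes "Ck (2 * j) {0..<1} f" "t \<in> {0..<1}"
  shows "(radial_laplace c ^^ j) f t = euler_ops j c ((ndiff ^^ j) f) t"
  using assms
proof (induction j arbitrary: f t)
  case (Suc j)
  have f1: "Ck (Suc (2 * j)) {0..<1} (ndiff f)" by (rule Ck_ndiff(1)) (use Suc.prems in simp)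
  have "(radial_laplace c ^^ Suc j) f t = (radial_laplace c ^^ j) (radial_laplace c f) t"
    by (simp add: funpow_swap1)
  also have "\<dots> = euler_ops j c ((ndiff ^^ j) (radial_laplace c f)) t"
    by (rule Suc.IH[OF _ Suc.prems(2)]) (simp add: radial_laplace_def Ck_euler_op[OF f1])
  \<comment> \<open>The \<open>j\<close> derivatives pass the Euler operator of the last factor and
    turn its parameter \<open>c\<close> into \<open>c + j\<close>, the new entry of the
    product.\<close>
  also have "\<dots> = euler_ops j c (euler_op (c + real j) ((ndiff ^^ j) (ndiff f))) t"
    unfolding radial_laplace_def
    by (rule euler_ops_cong[OF ndiffs_euler_op[OF Ck_le[OF f1]] Suc.prems(2)]) simp_all
  finally show ?case by (simp add: funpow_swap1)
qed simp

lemma euler_ops_euler_stack: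
  assumes "Ck 1 {0..<1} f" "c > 1" "t \<in> {0..<1}"
  shows "euler_ops j c (euler_stack j c f) t = f t"
proof (induction j)
  case (Suc j)
  have "euler_op (c + real j) (euler_stack (Suc j) c f) s = euler_stack j c f s" if s: "s \<in> {0..<1}" for s
  proof -
    have "Ck (Suc 0) {0..<1} (euler_stack j c f)" using Ck_euler_stack_left[OF assms(1,2)] by simp
    then obtain g where g: "continuous_on {0..<1} g"
      "\<And>t. t \<in> {0..<1} \<Longrightarrow> (euler_stack j c f has_real_derivative g t) (at t within {0..<1})" by auto
    have cj: "c + real j > 1" using assms(2) by simp
    have "(euler_stack (Suc j) c f has_real_derivative euler_inv (c + real j + 1) g s) (at s within {0..<1})"
      unfolding euler_stack.simps
      by (rule euler_inv_has_derivative[OF g(2,1) _ unit_left_star cj s]) auto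
    then have "ndiff (euler_stack (Suc j) c f) s = - euler_inv (c + real j + 1) g s"
      by (rule ndiff_eq[OF _ s])
    then show ?thesis
      using euler_inv_euler_operator[OF g(2,1) unit_left_star cj s] by (simp add: euler_op_def)
  qed
  then show ?case
    unfolding euler_ops.simps using euler_ops_cong[OF _ assms(3)] Suc by metis
qed simp

lemma ndiff_tail_ints:
  assumes "continuous_on {0..1} f" "t \<in> {0..<1}"
  shows "(ndiff ^^ k) ((tail_int ^^ k) f) t = f t"
  using assms
proof (induction k arbitrary: f t)
  case (Suc k)
  have "(ndiff ^^ Suc k) ((tail_int ^^ Suc k) f) t = ndiff ((ndiff ^^ k) ((tail_int ^^ k) (tail_int f))) t"
    by (simp add: funpow_swap1)
  also have "\<dots> = ndiff (tail_int f) t"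
    by (rule ndiff_cong[OF Suc.IH[OF tail_int_continuous[OF Suc.prems(1)]] Suc.prems(2)])
  also have "\<dots> = - (- f t)"
    using Suc.prems(2)
    by (intro ndiff_eq has_field_derivative_subset[OF tail_int_has_derivative[OF Suc.prems(1)]]) auto
  finally show ?case by simp
qed simp

lemma radial_laplaces_green:
  assumes "continuous_on {0..1} f" "Ck m {0..<1} f" "m \<ge> 1" "c > 1" "t \<in> {0..<1}"
  shows "(radial_laplace c ^^ m) (green m c f) t = f t / 4 ^ m"
proof -
  let ?f = "\<lambda>s. (1 / 4 ^ m) * f s"
  have cf: "continuous_on {0..1} ?f" by (intro continuous_intros assms)
  have "(radial_laplace c ^^ m) (green m c f) t = euler_ops m c ((ndiff ^^ m) (green m c f)) t"
    by (rule radial_laplaces_eq[OF Ck_subset[OF Ck_green[OF assms(1,4,2)]] assms(5)]) auto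
  also have "\<dots> = euler_ops m c (euler_stack m c ?f) t"
    unfolding green_alt
    by (rule euler_ops_cong[OF ndiff_tail_ints[OF euler_stack_continuous_unit[OF cf assms(4)]] assms(5)])
  also have "\<dots> = ?f t"
    by (rule euler_ops_euler_stack[OF Ck_le[OF Ck_cmult[OF assms(2)] assms(3)] assms(4,5)])
  finally show ?thesis by simp
qed

section \<open>The Laplacian of radial functions\<close>

lemma norm_less_1_iff_inner: "norm x < 1 \<longleftrightarrow> x \<bullet> x < 1" for x :: "'a::euclidean_space"
  by (simp add: norm_eq_sqrt_inner)

lemma norm_le_1_iff_inner: "norm x \<le> 1 \<longleftrightarrow> x \<bullet> x \<le> 1" for x :: "'a::euclidean_space"
  by (simp add: norm_eq_sqrt_inner)

text \<open>At \<open>y = 0\<close> only a one-sided derivative of \<open>f\<close> is available.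
  The chain rule within the image suffices, because the squared length near \<open>s = 0\<close>
  stays in \<open>{0..<1}\<close>.\<close>

lemma radial_has_derivative:
  fixes y b :: "'a::euclidean_space"
  assumes f: "\<And>t. t \<in> {0..<1} \<Longrightarrow> (f has_real_derivative g t) (at t within {0..<1})"
    and y: "y \<in> ball 0 1"
  shows "((\<lambda>s. f ((y + s *\<^sub>R b) \<bullet> (y + s *\<^sub>R b))) has_real_derivative g (y \<bullet> y) * (2 * (y \<bullet> b))) (at 0)"
proof -
  define h where "h s = (y + s *\<^sub>R b) \<bullet> (y + s *\<^sub>R b)" for s :: real
  define S where "S = {s. h s < 1}"
  have h: "h s = y \<bullet> y + 2 * s * (y \<bullet> b) + s * s * (b \<bullet> b)" for s
    by (simp add: h_def inner_add_left inner_add_right inner_commute algebra_simps)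
  have cont: "continuous_on UNIV h" unfolding h[abs_def] by (intro continuous_intros)
  have "open S" unfolding S_def by (rule open_Collect_less[OF cont continuous_on_const])
  have 0: "0 \<in> S" using y by (simp add: S_def h norm_less_1_iff_inner)
  have "h ` S \<subseteq> {0..<1}" by (auto simp: S_def h_def)
  moreover have "h 0 \<in> {0..<1}" using 0 by (auto simp: S_def h_def)
  ultimately have "(f has_real_derivative g (h 0)) (at (h 0) within h ` S)"
    using has_field_derivative_subset[OF f] by blast
  moreover have "(h has_real_derivative 2 * (y \<bullet> b)) (at 0 within S)"
    unfolding h[abs_def] by (auto intro!: derivative_eq_intros)
  ultimately have "(f \<circ> h has_real_derivative g (h 0) * (2 * (y \<bullet> b))) (at 0 within S)"
    by (rule DERIV_image_chain)
  then show ?thesis using at_within_open[OF 0 \<open>open S\<close>] by (simp add: o_def h_def)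
qed

lemma eventually_line_in_open:
  fixes x b :: "'a::euclidean_space"
  assumes "open S" "x \<in> S"
  shows "\<forall>\<^sub>F s in nhds 0. x + s *\<^sub>R b \<in> S"
proof -
  have "open ((\<lambda>s::real. x + s *\<^sub>R b) -` S)"
    by (intro open_vimage assms continuous_intros)
  then show ?thesis using assms(2) unfolding eventually_nhds
    by (intro exI[of _ "(\<lambda>s. x + s *\<^sub>R b) -` S"]) auto
qed

lemma partial_deriv_cong:
  assumes "open S" "\<And>y. y \<in> S \<Longrightarrow> F y = G y" "x \<in> S"
  shows "partial_deriv b F x = partial_deriv b G x"
  unfolding partial_deriv_def
  by (rule deriv_cong_ev[OF eventually_mono[OF eventually_line_in_open[OF assms(1,3)]]]) (use assms in auto)

lemma laplacian_cong:
  assumes "open S" "\<And>y. y \<in> S \<Longrightarrow> F y = G y" "x \<in> S"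
  shows "laplacian F x = laplacian G x"
  unfolding laplacian_def
  by (intro sum.cong refl partial_deriv_cong[OF assms(1) partial_deriv_cong[OF assms(1,2)] assms(3)]) 

text \<open>The classical identity: the Laplacian of \<open>f\<close> in \<open>t = |x|^2\<close> is
  \<open>4 * (t * f'' + (N / 2) * f')\<close>. The factor \<open>k\<close> carries the powers of 4
  through the iteration.\<close>

lemma laplacian_radial:
  fixes x :: "'a::euclidean_space"
  assumes f: "Ck 2 {0..<1} f" and x: "x \<in> ball 0 1"
  shows "laplacian (\<lambda>y. k * f (y \<bullet> y)) x = - 4 * k * radial_laplace (DIM('a) / 2) f (x \<bullet> x)"
proof -
  have f2: "Ck (Suc (Suc 0)) {0..<1} f" using f by (simp only: numeral_2_eq_2)
  have f1: "Ck (Suc 0) {0..<1} (ndiff f)" by (rule Ck_ndiff(1)[OF f2])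
  define g where "g = ndiff f"
  have 1: "partial_deriv b (\<lambda>y. k * f (y \<bullet> y)) y = - 2 * k * ((y \<bullet> b) * g (y \<bullet> y))"
    if "y \<in> ball 0 1" for y b :: 'a
  proof -
    have "((\<lambda>s. k * f ((y + s *\<^sub>R b) \<bullet> (y + s *\<^sub>R b))) has_real_derivative
        k * (- g (y \<bullet> y) * (2 * (y \<bullet> b)))) (at 0)"
      unfolding g_def by (intro DERIV_cmult radial_has_derivative[OF Ck_ndiff(2)[OF f2] that])
    then show ?thesis unfolding partial_deriv_def by (simp add: DERIV_imp_deriv mult_ac)
  qed
  have 2: "partial_deriv b (\<lambda>y. - 2 * k * ((y \<bullet> b) * g (y \<bullet> y))) x =
      - 2 * k * (g (x \<bullet> x) - 2 * (x \<bullet> b)\<^sup>2 * ndiff g (x \<bullet> x))" if b: "b \<in> Basis" for b :: 'a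
  proof -
    have "((\<lambda>s. (x + s *\<^sub>R b) \<bullet> b) has_real_derivative 1) (at 0)"
      using b by (auto intro!: derivative_eq_intros simp: inner_add_left)
    then have "((\<lambda>s. - 2 * k * (((x + s *\<^sub>R b) \<bullet> b) * g ((x + s *\<^sub>R b) \<bullet> (x + s *\<^sub>R b))))
        has_real_derivative - 2 * k * (1 * g ((x + 0 *\<^sub>R b) \<bullet> (x + 0 *\<^sub>R b)) +
          (- ndiff g (x \<bullet> x) * (2 * (x \<bullet> b))) * ((x + 0 *\<^sub>R b) \<bullet> b))) (at 0)"
      unfolding g_def by (intro DERIV_cmult DERIV_mult radial_has_derivative[OF Ck_ndiff(2)[OF f1] x])
    then show ?thesis
      unfolding partial_deriv_def by (simp add: DERIV_imp_deriv power2_eq_square algebra_simps)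
  qed
  have "laplacian (\<lambda>y. k * f (y \<bullet> y)) x =
      (\<Sum>b\<in>Basis. partial_deriv b (\<lambda>y. - 2 * k * ((y \<bullet> b) * g (y \<bullet> y))) x)"
    unfolding laplacian_def by (intro sum.cong refl partial_deriv_cong[OF open_ball _ x] 1)
  also have "\<dots> = (\<Sum>b\<in>Basis. - 2 * k * (g (x \<bullet> x) - 2 * (x \<bullet> b)\<^sup>2 * ndiff g (x \<bullet> x)))"
    by (intro sum.cong refl 2)
  also have "\<dots> = - 2 * k * (DIM('a) * g (x \<bullet> x) - 2 * (\<Sum>b\<in>Basis. (x \<bullet> b)\<^sup>2) * ndiff g (x \<bullet> x))"
  proof -
    have "(\<Sum>b\<in>Basis. 2 * (x \<bullet> b)\<^sup>2 * ndiff g (x \<bullet> x)) = 2 * (\<Sum>b\<in>Basis. (x \<bullet> b)\<^sup>2) * ndiff g (x \<bullet> x)"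
      by (simp only: sum_distrib_left sum_distrib_right)
    then have "(\<Sum>b\<in>Basis. g (x \<bullet> x) - 2 * (x \<bullet> b)\<^sup>2 * ndiff g (x \<bullet> x)) =
        DIM('a) * g (x \<bullet> x) - 2 * (\<Sum>b\<in>Basis. (x \<bullet> b)\<^sup>2) * ndiff g (x \<bullet> x)"
      by (simp add: sum_subtractf)
    then show ?thesis by (metis sum_distrib_left)
  qed
  also have "(\<Sum>b\<in>Basis. (x \<bullet> b)\<^sup>2) = x \<bullet> x"
    by (subst euclidean_inner) (simp add: power2_eq_square)
  finally show ?thesis by (simp add: radial_laplace_def euler_op_def g_def algebra_simps)
qed

lemma polyharmonic_radial:
  fixes x :: "'a::euclidean_space"
  assumes "Ck (2 * j) {0..<1} f" "x \<in> ball 0 1"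
  shows "polyharmonic j (\<lambda>y. f (y \<bullet> y)) x = 4 ^ j * (radial_laplace (DIM('a) / 2) ^^ j) f (x \<bullet> x)"
  using assms
proof (induction j arbitrary: x)
  case (Suc j)
  let ?R = "radial_laplace (DIM('a) / 2)"
  have "Ck (2 * j) {0..<1} f" by (rule Ck_le[OF Suc.prems(1)]) simp
  then have "laplacian (polyharmonic j (\<lambda>y. f (y \<bullet> y))) x = laplacian (\<lambda>y. 4 ^ j * (?R ^^ j) f (y \<bullet> y)) x"
    by (intro laplacian_cong[OF open_ball Suc.IH Suc.prems(2)]) auto
  also have "\<dots> = - 4 * 4 ^ j * ?R ((?R ^^ j) f) (x \<bullet> x)"
    by (rule laplacian_radial[OF Ck_radial_laplaces Suc.prems(2)]) (use Suc.prems(1) in simp)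
  finally show ?case by simp
qed simp

section \<open>Regularity of radial functions on the closed ball\<close>

lemma C_closure_SucE:
  assumes "f \<in> C_closure (Suc k) S" "b \<in> Basis"
  obtains g where "g \<in> C_closure k S"
    "\<And>x. x \<in> S \<Longrightarrow> ((\<lambda>t. f (x + t *\<^sub>R b)) has_real_derivative g x) (at 0)"
  using assms by (simp only: C_closure.simps(2) mem_Collect_eq) metis

lemma C_closure_continuous: "f \<in> C_closure k S \<Longrightarrow> continuous_on (closure S) f"
  by (cases k) simp_all

lemma C_closure_SucI:
  assumes "continuous_on (closure S) f"
    "\<And>b. b \<in> Basis \<Longrightarrow> \<exists>g\<in>C_closure k S. \<forall>x\<in>S. ((\<lambda>t. f (x + t *\<^sub>R b)) has_real_derivative g x) (at 0)"
  shows "f \<in> C_closure (Suc k) S"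
  using assms by (simp only: C_closure.simps(2) mem_Collect_eq) simp

lemma C_closure_Suc_D: "f \<in> C_closure (Suc k) S \<Longrightarrow> f \<in> C_closure k S"
proof (induction k arbitrary: f)
  case 0
  then show ?case using C_closure_continuous[OF 0] by simp
next
  case (Suc k)
  show ?case
  proof (rule C_closure_SucI[OF C_closure_continuous[OF Suc.prems]])
    fix b :: 'a assume "b \<in> Basis"
    from C_closure_SucE[OF Suc.prems this] obtain g where "g \<in> C_closure (Suc k) S"
      "\<And>x. x \<in> S \<Longrightarrow> ((\<lambda>t. f (x + t *\<^sub>R b)) has_real_derivative g x) (at 0)" by metis
    then show "\<exists>g\<in>C_closure k S. \<forall>x\<in>S. ((\<lambda>t. f (x + t *\<^sub>R b)) has_real_derivative g x) (at 0)"
      by (intro bexI[of _ g] ballI Suc.IH) auto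
  qed
qed

lemma C_closure_const: "(\<lambda>_. a) \<in> C_closure k S"
proof (induction k arbitrary: a)
  case (Suc k)
  show ?case by (rule C_closure_SucI) (auto intro!: bexI[OF _ Suc.IH[of 0]])
qed simp

lemma C_closure_inner: "(\<lambda>x. a * (x \<bullet> b)) \<in> C_closure k S"
proof (cases k)
  case (Suc j)
  show ?thesis unfolding Suc
  proof (rule C_closure_SucI)
    show "\<exists>g\<in>C_closure j S. \<forall>x\<in>S. ((\<lambda>t. a * ((x + t *\<^sub>R i) \<bullet> b)) has_real_derivative g x) (at 0)" for i
      by (rule bexI[OF _ C_closure_const[of "a * (i \<bullet> b)"]])
         (auto intro!: derivative_eq_intros simp: inner_add_left)
  qed (auto intro!: continuous_intros)
qed (auto intro!: continuous_intros)

lemma C_closure_add: "f \<in> C_closure k S \<Longrightarrow> g \<in> C_closure k S \<Longrightarrow> (\<lambda>x. f x + g x) \<in> C_closure k S"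
proof (induction k arbitrary: f g)
  case (Suc k)
  show ?case
  proof (rule C_closure_SucI)
    show "continuous_on (closure S) (\<lambda>x. f x + g x)"
      by (intro continuous_intros C_closure_continuous[OF Suc.prems(1)] C_closure_continuous[OF Suc.prems(2)])
    fix b :: 'a assume b: "b \<in> Basis"
    obtain f' where f': "f' \<in> C_closure k S"
      "\<And>x. x \<in> S \<Longrightarrow> ((\<lambda>t. f (x + t *\<^sub>R b)) has_real_derivative f' x) (at 0)"
      using C_closure_SucE[OF Suc.prems(1) b] by metis
    obtain g' where g': "g' \<in> C_closure k S"
      "\<And>x. x \<in> S \<Longrightarrow> ((\<lambda>t. g (x + t *\<^sub>R b)) has_real_derivative g' x) (at 0)"
      using C_closure_SucE[OF Suc.prems(2) b] by metis
    show "\<exists>h\<in>C_closure k S. \<forall>x\<in>S. ((\<lambda>t. f (x + t *\<^sub>R b) + g (x + t *\<^sub>R b)) has_real_derivative h x) (at 0)"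
      by (rule bexI[OF _ Suc.IH[OF f'(1) g'(1)]]) (intro ballI DERIV_add f'(2) g'(2))
  qed
qed (auto intro: continuous_intros)

lemma C_closure_mult: "f \<in> C_closure k S \<Longrightarrow> g \<in> C_closure k S \<Longrightarrow> (\<lambda>x. f x * g x) \<in> C_closure k S"
proof (induction k arbitrary: f g)
  case (Suc k)
  show ?case
  proof (rule C_closure_SucI)
    show "continuous_on (closure S) (\<lambda>x. f x * g x)"
      by (intro continuous_intros C_closure_continuous[OF Suc.prems(1)] C_closure_continuous[OF Suc.prems(2)])
    fix b :: 'a assume b: "b \<in> Basis"
    obtain f' where f': "f' \<in> C_closure k S"
      "\<And>x. x \<in> S \<Longrightarrow> ((\<lambda>t. f (x + t *\<^sub>R b)) has_real_derivative f' x) (at 0)"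
      using C_closure_SucE[OF Suc.prems(1) b] by metis
    obtain g' where g': "g' \<in> C_closure k S"
      "\<And>x. x \<in> S \<Longrightarrow> ((\<lambda>t. g (x + t *\<^sub>R b)) has_real_derivative g' x) (at 0)"
      using C_closure_SucE[OF Suc.prems(2) b] by metis
    have "((\<lambda>t. f (x + t *\<^sub>R b) * g (x + t *\<^sub>R b)) has_real_derivative f' x * g x + g' x * f x) (at 0)"
      if "x \<in> S" for x
      using DERIV_mult[OF f'(2)[OF that] g'(2)[OF that]] by simp
    moreover have "(\<lambda>x. f' x * g x + g' x * f x) \<in> C_closure k S"
      by (intro C_closure_add Suc.IH f' g' C_closure_Suc_D[OF Suc.prems(1)] C_closure_Suc_D[OF Suc.prems(2)])
    ultimately show "\<exists>h\<in>C_closure k S. \<forall>x\<in>S.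
        ((\<lambda>t. f (x + t *\<^sub>R b) * g (x + t *\<^sub>R b)) has_real_derivative h x) (at 0)"
      by (intro bexI ballI)
  qed
qed (auto intro: continuous_intros)

text \<open>A partial derivative of a radial function is a radial function times a linear one, so
  the induction needs only closure under products.\<close>

lemma C_closure_radial:
  "Ck k {0..1} f \<Longrightarrow> (\<lambda>x::'a::euclidean_space. f (x \<bullet> x)) \<in> C_closure k (ball 0 1)"
proof (induction k arbitrary: f)
  case 0
  have "continuous_on (cball 0 1) (\<lambda>x::'a. f (x \<bullet> x))"
    by (rule continuous_on_compose2[of "{0..1}" f])
       (use 0 in \<open>auto intro!: continuous_intros simp: norm_le_1_iff_inner\<close>)
  then show ?case by simp
next
  case (Suc k)
  obtain g where g: "Ck k {0..1} g" "\<And>t. t \<in> {0..1} \<Longrightarrow> (f has_real_derivative g t) (at t within {0..1})"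
    using Suc.prems by auto
  have g': "(f has_real_derivative g t) (at t within {0..<1})" if "t \<in> {0..<1}" for t
    by (rule has_field_derivative_subset[OF g(2)]) (use that in auto)
  have cont: "continuous_on (cball 0 1) (\<lambda>x::'a. f (x \<bullet> x))"
    by (rule continuous_on_compose2[OF Ck_continuous[OF Suc.prems]])
       (auto intro!: continuous_intros simp: norm_le_1_iff_inner)
  show ?case
  proof (rule C_closure_SucI)
    show "continuous_on (closure (ball 0 1)) (\<lambda>x::'a. f (x \<bullet> x))" using cont by simp
    show "\<exists>h\<in>C_closure k (ball 0 1). \<forall>x\<in>ball 0 1.
      ((\<lambda>t. f ((x + t *\<^sub>R b) \<bullet> (x + t *\<^sub>R b))) has_real_derivative h x) (at 0)" for b :: 'a
      by (rule bexI[OF _ C_closure_mult[OF Suc.IH[OF g(1)] C_closure_inner[of 2 b]]])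
         (intro ballI radial_has_derivative[OF g'])
  qed
qed

section \<open>The Dirichlet conditions\<close>

text \<open>A zero of order \<open>k\<close> at \<open>a\<close>: the derivatives of orders 0 to
  \<open>k - 1\<close> vanish there. Derivatives are witnesses taken within \<open>T\<close>, so
  that sums and products can be handled without computing iterated derivatives.\<close>

primrec flat :: "nat \<Rightarrow> real set \<Rightarrow> real \<Rightarrow> (real \<Rightarrow> real) \<Rightarrow> bool" where
  "flat 0 T a f \<longleftrightarrow> True"
| "flat (Suc k) T a f \<longleftrightarrow> f a = 0 \<and>
     (\<exists>g. flat k T a g \<and> (\<forall>t\<in>T. (f has_real_derivative g t) (at t within T)))"

lemma flat_add: "flat k T a f \<Longrightarrow> flat k T a g \<Longrightarrow> flat k T a (\<lambda>t. f t + g t)"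
proof (induction k arbitrary: f g)
  case (Suc k)
  then obtain f' g' where "flat k T a f'" "\<forall>t\<in>T. (f has_real_derivative f' t) (at t within T)"
    "flat k T a g'" "\<forall>t\<in>T. (g has_real_derivative g' t) (at t within T)" by auto
  with Suc show ?case by (auto intro!: exI[of _ "\<lambda>t. f' t + g' t"] DERIV_add)
qed simp

text \<open>On the normal line the squared length is \<open>(1 + t)\<^sup>2\<close>, and each
  derivative removes one tail integral and creates a factor \<open>- 2 * (1 + t)\<close>. The
  polynomial \<open>w\<close> absorbs these factors; the term in which \<open>w\<close> is
  differentiated keeps all its integrals, one of which is counted into the datum
  \<open>h\<close>.\<close>

lemma flat_tail_ints:
  assumes "continuous_on {0..1} h"
  shows "flat k {-2..0} 0 (\<lambda>t. poly w t * (tail_int ^^ k) h ((1 + t)\<^sup>2))"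
  using assms
proof (induction k arbitrary: w h)
  case (Suc k)
  let ?H = "(tail_int ^^ k) h"
  have sq: "(1 + t)\<^sup>2 \<in> {0..1}" if "t \<in> {-2..0}" for t :: real
  proof -
    have "\<bar>1 + t\<bar> \<le> 1" using that by auto
    then show ?thesis by (simp add: abs_square_le_1)
  qed
  have "((\<lambda>t. poly w t * (tail_int ^^ Suc k) h ((1 + t)\<^sup>2)) has_real_derivative
      poly (pderiv w) t * (tail_int ^^ k) (tail_int h) ((1 + t)\<^sup>2) +
      poly (w * [:- 2, - 2:]) t * ?H ((1 + t)\<^sup>2)) (at t within {-2..0})" if t: "t \<in> {-2..0}" for t
  proof -
    have "(tail_int ?H has_real_derivative - ?H ((1 + t)\<^sup>2)) (at ((1 + t)\<^sup>2) within (\<lambda>t. (1 + t)\<^sup>2) ` {-2..0})"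
      by (rule has_field_derivative_subset[OF tail_int_has_derivative[OF tail_ints_continuous[OF Suc.prems] sq[OF t]]])
         (use sq in blast)
    moreover have "((\<lambda>t. (1 + t)\<^sup>2) has_real_derivative 2 * (1 + t)) (at t within {-2..0})"
      by (auto intro!: derivative_eq_intros)
    ultimately have "((tail_int ?H) \<circ> (\<lambda>t. (1 + t)\<^sup>2) has_real_derivative - ?H ((1 + t)\<^sup>2) * (2 * (1 + t)))
        (at t within {-2..0})"
      by (rule DERIV_image_chain)
    from DERIV_mult[OF has_field_derivative_at_within[OF poly_DERIV[of w t]] this]
    show ?thesis by (simp add: o_def funpow_swap1 algebra_simps)
  qed
  moreover have "flat k {-2..0} 0 (\<lambda>t. poly (pderiv w) t * (tail_int ^^ k) (tail_int h) ((1 + t)\<^sup>2) +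
      poly (w * [:- 2, - 2:]) t * ?H ((1 + t)\<^sup>2))"
    by (intro flat_add Suc.IH tail_int_continuous Suc.prems)
  ultimately show ?case by auto
qed simp

text \<open>\<open>deriv_within\<close> adds derivatives at the outer end, whereas
  \<open>flat\<close> exposes the first derivative; this exchanges the two orders. Nontrivial
  filters make derivatives within \<open>T\<close> unique.\<close>

lemma deriv_within_Suc_inner:
  assumes f: "\<And>t. t \<in> T \<Longrightarrow> (f has_real_derivative g t) (at t within T)"
    and T: "\<And>t. t \<in> T \<Longrightarrow> at t within T \<noteq> bot" and t: "t \<in> T"
  shows "deriv_within (Suc r) T f t = deriv_within r T g t"
  using t
proof (induction r arbitrary: t)
  case 0
  then show ?case
    using vector_derivative_within[OF T f[unfolded has_real_derivative_iff_has_vector_derivative]] by simp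
next
  case (Suc r)
  have "vector_derivative (deriv_within (Suc r) T f) (at t within T) =
        vector_derivative (deriv_within r T g) (at t within T)"
    by (rule vector_derivative_within_cong[OF Suc.IH Suc.prems])
  then show ?case by simp
qed

lemma flat_deriv_within:
  assumes "flat k T a f" "r < k" "a \<in> T" "\<And>t. t \<in> T \<Longrightarrow> at t within T \<noteq> bot"
  shows "deriv_within r T f a = 0"
  using assms(1,2)
proof (induction r arbitrary: k f)
  case 0
  then show ?case by (cases k) auto
next
  case (Suc r)
  then obtain j g where k: "k = Suc j" and g: "flat j T a g"
    "\<And>t. t \<in> T \<Longrightarrow> (f has_real_derivative g t) (at t within T)"
    by (cases k) auto
  then show ?case
    using deriv_within_Suc_inner[OF g(2) assms(4,3)] Suc.IH[OF g(1)] Suc.prems by simp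
qed

lemma dirichlet_radial_green:
  assumes "continuous_on {0..1} f" "c > 1"
  shows "dirichlet_unit_ball m (\<lambda>x::'a::euclidean_space. green m c f (x \<bullet> x))"
  unfolding dirichlet_unit_ball_def
proof (intro ballI allI impI)
  fix x :: 'a and r assume x: "x \<in> sphere 0 1" and r: "r < m"
  have xx: "x \<bullet> x = 1" using x by (simp add: norm_eq_1)
  have line: "x + t *\<^sub>R x = (1 + t) *\<^sub>R x" for t by (simp add: scaleR_add_left)
  \<comment> \<open>The line through \<open>x\<close> in its own direction meets the closed ball in
    a diameter; the boundary point is the right end \<open>t = 0\<close>.\<close>
  have T: "{t. x + t *\<^sub>R x \<in> closure (ball 0 1)} = {-2..0::real}"
    using x unfolding line by (auto simp: abs_le_iff)
  let ?h = "euler_stack m c (\<lambda>s. (1 / 4 ^ m) * f s)"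
  have on_line: "(\<lambda>t. green m c f ((x + t *\<^sub>R x) \<bullet> (x + t *\<^sub>R x))) =
      (\<lambda>t. poly 1 t * (tail_int ^^ m) ?h ((1 + t)\<^sup>2))"
    unfolding line green_alt using xx by (simp add: power2_eq_square)
  have "flat m {-2..0} 0 (\<lambda>t. poly 1 t * (tail_int ^^ m) ?h ((1 + t)\<^sup>2))"
    by (intro flat_tail_ints euler_stack_continuous_unit continuous_intros assms)
  then have "deriv_within r {-2..0} (\<lambda>t. poly 1 t * (tail_int ^^ m) ?h ((1 + t)\<^sup>2)) 0 = 0"
  proof (rule flat_deriv_within[OF _ r])
    fix t :: real assume "t \<in> {-2..0}"
    moreover have "{-2..0::real} \<noteq> {z}" for z
      by (metis atLeastAtMost_singleton_iff neg_equal_0_iff_equal zero_neq_numeral)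
    ultimately show "at t within {-2..0} \<noteq> bot" by (intro at_within_interval_nontrivial) auto
  qed auto
  then show "normal_deriv (ball 0 1) x r (\<lambda>x. green m c f (x \<bullet> x)) x = 0"
    unfolding normal_deriv_def T on_line .
qed

section \<open>Assembling the classical solution\<close>

theorem corollary2:
  fixes \<alpha> :: nat and p q :: real
  assumes "\<alpha> \<ge> 1"
    and "CARD('n::finite) > 2 * \<alpha>"
    and "p \<ge> 1" and "q \<ge> 1" and "\<not> (p = 1 \<and> q = 1)"
    and "1 / (p + 1) + 1 / (q + 1) > (real CARD('n) - 2 * real \<alpha>) / real CARD('n)"
  shows "\<exists>u v :: real ^ 'n \<Rightarrow> real.
           classical_solution \<alpha> p q u v \<and> (\<exists>x\<in>cball 0 1. (u x, v x) \<noteq> (0, 0))"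
proof -
  define c where "c = real CARD('n) / 2"
  have c: "c > 1" using assms(1,2) by (simp add: c_def)
  have dim: "real DIM(real ^ 'n) / 2 = c" by (simp add: c_def)
  \<comment> \<open>Multiplying the subcritical condition by \<open>c = N / 2\<close> brings it to
    the form in the exponents \<open>c / (p + 1)\<close> and \<open>c / (q + 1)\<close>.\<close>
  have "c * ((real CARD('n) - 2 * real \<alpha>) / real CARD('n)) < c * (1 / (p + 1) + 1 / (q + 1))"
    using assms(6) c by (intro mult_strict_left_mono) auto
  moreover have "c * ((real CARD('n) - 2 * real \<alpha>) / real CARD('n)) = c - real \<alpha>"
    by (simp add: c_def field_simps)
  ultimately have sub: "c / (p + 1) + c / (q + 1) > c - real \<alpha>" by (simp add: algebra_simps)
  from radial_solution[OF assms(1) c assms(3,4,5) sub] obtain f g where fg: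
    "continuous_on {0..1} f" "continuous_on {0..1} g"
    "\<forall>t\<in>{0..1}. 0 \<le> f t \<and> 0 \<le> g t" "\<forall>t\<in>{0..<1}. 0 < f t \<and> 0 < g t"
    "\<forall>t\<in>{0..1}. green \<alpha> c (\<lambda>s. f s powr p) t = g t \<and> green \<alpha> c (\<lambda>s. g s powr q) t = f t"
    by (elim exE conjE)
  have nonneg: "0 \<le> f t" "0 \<le> g t" if "t \<in> {0..1}" for t using bspec[OF fg(3) that] by auto
  have pos: "0 < f t" "0 < g t" if "t \<in> {0..<1}" for t using bspec[OF fg(4) that] by auto
  have eq: "green \<alpha> c (\<lambda>s. f s powr p) t = g t" "green \<alpha> c (\<lambda>s. g s powr q) t = f t"
    if "t \<in> {0..1}" for t using bspec[OF fg(5) that] by auto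
  \<comment> \<open>The first regularity pass: a profile that is a Green potential has
    \<open>\<alpha>\<close> derivatives, and positivity off the boundary hands them on to its real
    powers.\<close>
  have Ck_powr_profile: "Ck \<alpha> {0..<1} (\<lambda>s. h s powr r)"
    if pos: "\<And>t. t \<in> {0..<1} \<Longrightarrow> 0 < h t"
      and k: "continuous_on {0..1} k" "\<And>t. t \<in> {0..1} \<Longrightarrow> green \<alpha> c k t = h t" for h k r
  proof -
    have "Ck \<alpha> {0..1} h" by (rule Ck_cong[OF Ck_green_continuous[OF k(1) c] k(2)])
    then have "Ck \<alpha> {0..<1} h" by (rule Ck_subset) auto
    then show ?thesis by (rule Ck_powr[OF _ pos])
  qed
  have cf: "continuous_on {0..1} (\<lambda>s. f s powr p)" "continuous_on {0..1} (\<lambda>s. g s powr q)"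
    using assms(3,4) by (auto intro!: continuous_on_powr_nonneg[OF fg(1) nonneg(1)]
        continuous_on_powr_nonneg[OF fg(2) nonneg(2)])
  have Cf: "Ck \<alpha> {0..<1} (\<lambda>s. f s powr p)" by (rule Ck_powr_profile[OF pos(1) cf(2) eq(2)])
  have Cg: "Ck \<alpha> {0..<1} (\<lambda>s. g s powr q)" by (rule Ck_powr_profile[OF pos(2) cf(1) eq(1)])
  \<comment> \<open>Potentials are used in place of \<open>f\<close> and \<open>g\<close>, with
    which they agree on \<open>{0..1}\<close>: regularity, boundary values and equation are all
    established for \<open>green\<close>.\<close>
  define U where "U = (\<lambda>x::real ^ 'n. green \<alpha> c (\<lambda>s. g s powr q) (x \<bullet> x))"
  define V where "V = (\<lambda>x::real ^ 'n. green \<alpha> c (\<lambda>s. f s powr p) (x \<bullet> x))"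
  have poly: "polyharmonic \<alpha> (\<lambda>x::real ^ 'n. green \<alpha> c h (x \<bullet> x)) x = h (x \<bullet> x)"
    if h: "continuous_on {0..1} h" "Ck \<alpha> {0..<1} h" and x: "x \<in> ball 0 1" for h x
  proof -
    have "x \<bullet> x \<in> {0..<1}" using x by (auto simp: norm_less_1_iff_inner)
    then show ?thesis
      using polyharmonic_radial[OF Ck_subset[OF Ck_green[OF h(1) c h(2)]] x]
        radial_laplaces_green[OF h assms(1) c] by (simp add: c_def atLeastLessThan_subseteq_atLeastAtMost_iff)
  qed
  have "classical_solution \<alpha> p q U V"
    unfolding classical_solution_def
  proof (intro conjI ballI)
    show "U \<in> C_closure (2 * \<alpha>) (ball 0 1)" "V \<in> C_closure (2 * \<alpha>) (ball 0 1)"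
      unfolding U_def V_def by (intro C_closure_radial Ck_green cf Cf Cg c)+
    show "dirichlet_unit_ball \<alpha> U" "dirichlet_unit_ball \<alpha> V"
      unfolding U_def V_def by (intro dirichlet_radial_green cf c)+
    fix x :: "real ^ 'n" assume x: "x \<in> ball 0 1"
    then have xx: "x \<bullet> x \<in> {0..1}" by (auto simp: norm_less_1_iff_inner)
    show "polyharmonic \<alpha> U x = \<bar>V x\<bar> powr q"
      unfolding U_def V_def poly[OF cf(2) Cg x] using nonneg(2)[OF xx] eq(1)[OF xx] by simp
    show "polyharmonic \<alpha> V x = \<bar>U x\<bar> powr p"
      unfolding U_def V_def poly[OF cf(1) Cf x] using nonneg(1)[OF xx] eq(2)[OF xx] by simp
  qed
  moreover have "U 0 \<noteq> 0" using pos(1)[of 0] eq(2)[of 0] by (simp add: U_def)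
  ultimately show ?thesis
    by (intro exI[of _ U] exI[of _ V]) (auto intro!: bexI[of _ 0])
qed

end
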